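(* Let $r\ge1$ and assume $p_0\in\mathcal C^r(\mathcal X)$. (a) If $p_0$ is an upper-supersmooth density function of order $\alpha>0$, then there exist universal constants $C'$, $\{C'_i\}_{i=1}^r$ and $\{\bar C_i\}_{i=1}^r$ such that for every $R\ge C'$ and $1\le i\le r$, $$\sup_{x\in\mathcal X}\left\|\mathbb{E}[\nabla^i\widehat f_{n,R}(x)]-\nabla^ip_0(x)\right\|_{\max}\le C'_i\,R^{\max\{1+i-\alpha,0\}}\exp(-C_1R^\alpha),$$ $$\sup_{x\in\mathcal X}\mathbb{E}\left[\left\|\nabla^i\widehat f_{n,R}(x)-\mathbb{E}[\nabla^i\widehat f_{n,R}(x)]\right\|_2^2\right]\le\bar C_i\cdot\frac{R^{2i+d}}{n},$$ where $C_1$ is the constant associated with the upper-supersmoothness of $p_0$. (b) If $p_0$ is an upper-ordinary smooth density function of order $\beta>1+r$, then there exist universal constants $\{c_i\}_{i=1}^r$ and $\{\bar C_i\}_{i=1}^r$ such that for every $R>0$ and $1\le i\le r$, $$\sup_{x\in\mathcal X}\left\|\mathbb{E}[\nabla^i\widehat f_{n,R}(x)]-\nabla^ip_0(x)\right\|_{\max}\le\frac{c_i}{R^{\beta-(i+1)}},$$ $$\sup_{x\in\mathcal X}\mathbb{E}\left[\left\|\nabla^i\widehat f_{n,R}(x)-\mathbb{E}[\nabla^i\widehat f_{n,R}(x)]\right\|_2^2\right]\le\bar C_i\cdot\frac{R^{2i+d}}{n}.$$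
   Context: $X_1,\dots,X_n\in\mathcal X\subset\mathbb{R}^d$ are i.i.d. with density $p_0$; $X_i=(X_{i1},\dots,X_{id})$. For $R>0$ the Fourier density estimator is $$\widehat f_{n,R}(x)=\frac{1}{n\pi^d}\sum_{i=1}^n\prod_{j=1}^d\frac{\sin(R(x_j-X_{ij}))}{x_j-X_{ij}},$$ with $\sin(Ru)/u=R$ at $u=0$. Fourier transform: $\widehat h(s)=\int_{\mathbb{R}^d}h(t)e^{-is^\top t}\,dt$. $p_0$ is upper-supersmooth of order $\alpha$ if there are positive constants $C_0,C_1$ with $|\widehat{p_0}(s)|\le C_0\exp(-C_1\sum_{j=1}^d|s_j|^\alpha)$ for all $s\in\mathbb{R}^d$. $p_0$ is upper-ordinary smooth of order $\beta$ if there is $c_0>0$ with $|\widehat{p_0}(s)|\le c_0\prod_{j=1}^d\frac{1}{1+|s_j|^\beta}$ for all $s\in\mathbb{R}^d$. $\mathcal C^r(\mathcal X)$ is the set of functions on $\mathcal X$ that have bounded integrable continuous derivatives up to the $r$-th order. $\nabla^ih$ is the $i$-th order derivative tensor with entries $(\nabla^ih)_{u_1\dots u_i}$, $1\le u_1,\dots,u_i\le d$; $\|\cdot\|_{\max}$ is the maximum absolute entry and $\|\cdot\|_2$ the square root of the sum of squared entries. "Universal constant" means a positive constant not depending on $n$, $R$ or $x$ (it may depend on $d$, $r$, the smoothness order and constants, and $p_0$). *)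

theory Defs
  imports "HOL-Probability.Probability"
begin

definition fourier_kernel :: "real \<Rightarrow> real \<Rightarrow> real" where
  "fourier_kernel R u = (if u = 0 then R else sin (R * u) / u)"

definition fourier_density_estimator ::
    "nat \<Rightarrow> real \<Rightarrow> (nat \<Rightarrow> real ^ 'd) \<Rightarrow> real ^ 'd \<Rightarrow> real" where
  "fourier_density_estimator n R obs x =
     1 / (real n * pi ^ CARD('d)) *
       (\<Sum>k<n. \<Prod>j\<in>UNIV. fourier_kernel R (x $ j - obs k $ j))"

definition fourier_transform :: "(real ^ 'd \<Rightarrow> real) \<Rightarrow> real ^ 'd \<Rightarrow> complex" where
  "fourier_transform h s =
     (LINT t|lborel. complex_of_real (h t) * exp (- \<i> * complex_of_real (s \<bullet> t)))"

text \<open>The constants of the supersmooth bound are arguments, because the rate obtained for the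
  estimator refers to the constant in the exponent.\<close>

definition upper_supersmooth ::
    "real \<Rightarrow> real \<Rightarrow> real \<Rightarrow> (real ^ 'd \<Rightarrow> real) \<Rightarrow> bool" where
  "upper_supersmooth \<alpha> C0 C1 p \<longleftrightarrow> C0 > 0 \<and> C1 > 0 \<and>
     (\<forall>s. cmod (fourier_transform p s) \<le> C0 * exp (- C1 * (\<Sum>j\<in>UNIV. \<bar>s $ j\<bar> powr \<alpha>)))"

definition upper_ordinary_smooth :: "real \<Rightarrow> (real ^ 'd \<Rightarrow> real) \<Rightarrow> bool" where
  "upper_ordinary_smooth \<beta> p \<longleftrightarrow>
     (\<exists>c0>0. \<forall>s. cmod (fourier_transform p s) \<le> c0 * (\<Prod>j\<in>UNIV. 1 / (1 + \<bar>s $ j\<bar> powr \<beta>)))"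

definition partial_deriv :: "'d \<Rightarrow> (real ^ 'd \<Rightarrow> real) \<Rightarrow> real ^ 'd \<Rightarrow> real" where
  "partial_deriv j h x = deriv (\<lambda>t. h (x + t *\<^sub>R axis j 1)) 0"

primrec iter_partial :: "'d list \<Rightarrow> (real ^ 'd \<Rightarrow> real) \<Rightarrow> real ^ 'd \<Rightarrow> real" where
  "iter_partial [] h = h"
| "iter_partial (j # u) h = partial_deriv j (iter_partial u h)"

text \<open>A tensor of order \<open>i\<close> over \<open>real ^ 'd\<close> is a function of multi-indices of type
  \<open>'d list\<close>, of which only the values at lists of length \<open>i\<close> matter. One function
  \<open>nabla h x\<close> therefore holds the derivative tensors of \<open>h\<close> at \<open>x\<close> of every order.\<close>

definition nabla :: "(real ^ 'd \<Rightarrow> real) \<Rightarrow> real ^ 'd \<Rightarrow> 'd list \<Rightarrow> real" where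
  "nabla h x = (\<lambda>u. iter_partial u h x)"

definition tensor_max_norm :: "nat \<Rightarrow> ('d::finite list \<Rightarrow> real) \<Rightarrow> real" where
  "tensor_max_norm i T = Max ((\<lambda>u. \<bar>T u\<bar>) ` {u. length u = i})"

definition tensor_norm2 :: "nat \<Rightarrow> ('d::finite list \<Rightarrow> real) \<Rightarrow> real" where
  "tensor_norm2 i T = sqrt (\<Sum>u | length u = i. (T u)\<^sup>2)"

definition tensor_expectation :: "'w measure \<Rightarrow> ('w \<Rightarrow> 'd list \<Rightarrow> real) \<Rightarrow> 'd list \<Rightarrow> real" where
  "tensor_expectation M T = (\<lambda>u. LINT \<omega>|M. T \<omega> u)"

text \<open>The class of r times continuously differentiable functions on an arbitrary set \<open>S\<close>:
  derivatives are ordinary two-sided derivatives, so they are required to exist and be continuous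
  on an open neighbourhood of \<open>S\<close> (which is \<open>S\<close> itself if \<open>S\<close> is open), whereas
  boundedness and integrability are required on \<open>S\<close> only.\<close>

definition C_class :: "nat \<Rightarrow> (real ^ 'd) set \<Rightarrow> (real ^ 'd \<Rightarrow> real) \<Rightarrow> bool" where
  "C_class r S h \<longleftrightarrow>
     (\<exists>U. open U \<and> S \<subseteq> U \<and>
        (\<forall>u j. length u < r \<longrightarrow>
           (\<forall>x\<in>U. (\<lambda>t. iter_partial u h (x + t *\<^sub>R axis j 1)) differentiable (at 0))) \<and>
        (\<forall>u. length u \<le> r \<longrightarrow> continuous_on U (iter_partial u h))) \<and>
     (\<forall>u. length u \<le> r \<longrightarrow>
        bounded (iter_partial u h ` S) \<and> set_integrable lborel S (iter_partial u h))"

definition prob_density :: "(real ^ 'd \<Rightarrow> real) \<Rightarrow> bool" where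
  "prob_density p \<longleftrightarrow> (\<forall>x. 0 \<le> p x) \<and> has_bochner_integral lborel p 1"

definition iid_sample ::
    "'w measure \<Rightarrow> nat \<Rightarrow> (nat \<Rightarrow> 'w \<Rightarrow> real ^ 'd) \<Rightarrow> (real ^ 'd) set \<Rightarrow> (real ^ 'd \<Rightarrow> real) \<Rightarrow> bool" where
  "iid_sample M n X S p \<longleftrightarrow> prob_space M \<and>
     prob_space.indep_vars M (\<lambda>_. borel) X {..<n} \<and>
     (\<forall>k<n. distributed M lborel (X k) (\<lambda>x. ennreal (p x)) \<and> (AE \<omega> in M. X k \<omega> \<in> S))"

text \<open>The derivative tensors at \<open>x\<close> of the estimator computed from the first \<open>n\<close>
  observations, as a random tensor.\<close>

definition nabla_estimator ::
    "nat \<Rightarrow> real \<Rightarrow> (nat \<Rightarrow> 'w \<Rightarrow> real ^ 'd) \<Rightarrow> real ^ 'd \<Rightarrow> 'w \<Rightarrow> 'd list \<Rightarrow> real" where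
  "nabla_estimator n R X x \<omega> = nabla (fourier_density_estimator n R (\<lambda>k. X k \<omega>)) x"

text \<open>The suprema are taken in the extended reals, so that they carry their usual meaning also for
  unbounded families.\<close>

definition sup_bias ::
    "'w measure \<Rightarrow> nat \<Rightarrow> real \<Rightarrow> (nat \<Rightarrow> 'w \<Rightarrow> real ^ 'd) \<Rightarrow> (real ^ 'd) set \<Rightarrow>
     (real ^ 'd \<Rightarrow> real) \<Rightarrow> nat \<Rightarrow> ereal" where
  "sup_bias M n R X S p i =
     (SUP x\<in>S. ereal (tensor_max_norm i
        (\<lambda>u. tensor_expectation M (nabla_estimator n R X x) u - nabla p x u)))"

definition sup_variance ::
    "'w measure \<Rightarrow> nat \<Rightarrow> real \<Rightarrow> (nat \<Rightarrow> 'w \<Rightarrow> real ^ 'd) \<Rightarrow> (real ^ 'd) set \<Rightarrow> nat \<Rightarrow> ereal" where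
  "sup_variance M n R X S i =
     (SUP x\<in>S. ereal (LINT \<omega>|M. (tensor_norm2 i
        (\<lambda>u. nabla_estimator n R X x \<omega> u - tensor_expectation M (nabla_estimator n R X x) u))\<^sup>2))"

end

theory Submission
  imports Defs
begin

text \<open>
Write \<open>K\<close> for the kernel \<open>K(t) = sin (R t) / t\<close>. A derivative of the estimator along a
multi-index \<open>u\<close> in which the coordinate \<open>j\<close> occurs \<open>k j\<close> times is the average over the sample of
products of the one-dimensional derivatives of order \<open>k j\<close> of \<open>K\<close> at \<open>x $ j - X $ j\<close>, divided
by \<open>pi ^ d\<close>.

The bias is a matter of Fourier inversion. Since \<open>K(t)\<close> is the integral of \<open>cos (s t)\<close> over \<open>[0, R]\<close>,
Fubini turns the mean of the differentiated estimator into the integral over the cube \<open>[-R, R] ^ d\<close>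
of \<open>m(s) exp (i s x) F(s) / (2 pi) ^ d\<close>, where \<open>F\<close> is the Fourier transform of the density and \<open>m(s)\<close>
is the product of the \<open>(i s $ j) ^ k j\<close> (\<open>integral_kernel_deriv_eq_fourier\<close>). The same integral over the
whole space is the derivative of the density (\<open>iter_partial_eq_fourier_inverse_deriv\<close>), so that the bias
is the integral over the complement of the cube. On that complement some coordinate exceeds \<open>R\<close>, and
a product bound on \<open>F\<close> leaves one one-dimensional tail integral times full moments of the other
coordinates (\<open>frequency_tail_le\<close>). Both smoothness classes provide such a product bound, with the factors
\<open>exp (- C1 |t| powr alpha)\<close> and \<open>1 / (1 + |t| powr beta)\<close>; the locale \<open>fourier_envelope\<close> treats them
together, and only the tail integrals are computed separately. These give the two rates.

Inversion itself, \<open>fourier_inversion_AE\<close>, is obtained from the same kernel. Integrated over a box, the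
mean of the estimator becomes the mean of a product of differences of sine integrals. As \<open>R\<close> grows
these tend to \<open>pi\<close> times the indicator of an interval, while the mean of the estimator tends to the
inverse Fourier integral. Density and inverse Fourier integral therefore have the same integral over every
box and agree almost everywhere. Where the density is continuous on an open set they agree everywhere
on it, and hence so do their derivatives.

For the variance, independence leaves \<open>1 / n\<close> times the second moment of one summand. The
inverse Fourier integral bounds the density by a constant, so this second moment is at most a constant
times the Lebesgue integral of the squared product, which factorises. Each factor is
\<open>O(R ^ (2 k j + 1))\<close>, because the derivative of order \<open>k\<close> of \<open>K\<close> at \<open>t\<close> is at most \<open>R ^ (k + 1)\<close> and at
most \<open>2 R ^ k / |t|\<close> (\<open>kernel_deriv_square_le\<close>). The exponents add up to \<open>2 i + d\<close>; the
uniform bound on the kernel alone would give \<open>2 i + 2 d\<close>.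
\<close>

section \<open>Lebesgue integrals over Cartesian space\<close>

lemma prod_Basis_cart: "(\<Prod>b\<in>Basis. f b) = (\<Prod>j\<in>UNIV. f (axis j (1::real)))"
  for f :: "real ^ 'd \<Rightarrow> 'b::comm_monoid_mult"
proof -
  have *: "Basis = range (\<lambda>j::'d. axis j (1::real))"
    by (auto simp: Basis_vec_def)
  show ?thesis
    unfolding * by (subst prod.reindex) (auto simp: inj_on_def axis_eq_axis)
qed

interpretation lborel_product: product_sigma_finite "\<lambda>_. lborel :: real measure"
  by standard

lemma sum_Basis_nth:
  fixes f :: "real ^ 'd \<Rightarrow> real"
  shows "(\<Sum>b\<in>Basis. f b *\<^sub>R b) $ j = f (axis j 1)"
proof -
  have "(\<Sum>b\<in>Basis. f b *\<^sub>R b) $ j = (\<Sum>b\<in>Basis. f b *\<^sub>R b) \<bullet> axis j 1"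
    by (simp add: cart_eq_inner_axis)
  also have "\<dots> = f (axis j 1)"
    by (subst inner_sum_left_Basis) (auto simp: Basis_vec_def)
  finally show ?thesis .
qed

text \<open>Transports the product rules for \<open>Pi\<^sub>M\<close> along the representation of \<open>lborel\<close> as the image of a
product measure indexed by \<open>Basis\<close>; the index set is then renamed to the coordinates.\<close>

lemma
  fixes f :: "'d::finite \<Rightarrow> real \<Rightarrow> 'b::{real_normed_field, banach, second_countable_topology}"
  assumes f: "\<And>j. integrable lborel (f j)"
  shows integrable_lborel_cart_prod: "integrable lborel (\<lambda>x::real ^ 'd. \<Prod>j\<in>UNIV. f j (x $ j))"
    and integral_lborel_cart_prod:
      "(LINT x|lborel. (\<Prod>j\<in>UNIV. f j ((x::real ^ 'd) $ j))) = (\<Prod>j\<in>UNIV. (LINT t|lborel. f j t))"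
proof -
  \<comment> \<open>the inverse of the bijection \<open>j \<mapsto> axis j 1\<close> onto \<open>Basis\<close>\<close>
  define h where "h b = f (SOME j. b = axis j 1)" for b :: "real ^ 'd"
  have h: "h (axis j 1) = f j" for j
    by (simp add: h_def axis_eq_axis)
  have [measurable]: "f j \<in> borel_measurable borel" for j
    using borel_measurable_integrable[OF f[of j]] by simp
  have h_int: "integrable lborel (h b)" for b
    by (simp add: h_def f)
  have eq: "(\<Prod>j\<in>UNIV. f j ((\<Sum>b\<in>Basis. g b *\<^sub>R b) $ j)) = (\<Prod>b\<in>Basis. h b (g b))"
    for g :: "real ^ 'd \<Rightarrow> real"
    by (simp add: prod_Basis_cart h sum_Basis_nth del: sum_component)
  have int: "integrable (\<Pi>\<^sub>M b\<in>(Basis::(real^'d) set). lborel) (\<lambda>g. \<Prod>b\<in>Basis. h b (g b))"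
    by (intro lborel_product.product_integrable_prod h_int) auto
  have [measurable]: "(\<lambda>g. \<Sum>b\<in>(Basis::(real^'d) set). g b *\<^sub>R b) \<in> (\<Pi>\<^sub>M b\<in>(Basis::(real^'d) set). lborel) \<rightarrow>\<^sub>M borel"
    by measurable
  show "integrable lborel (\<lambda>x::real ^ 'd. \<Prod>j\<in>UNIV. f j (x $ j))"
    by (subst lborel_eq, subst integrable_distr_eq) (simp_all only: eq int, measurable)
  show "(LINT x|lborel. (\<Prod>j\<in>UNIV. f j ((x::real ^ 'd) $ j))) = (\<Prod>j\<in>UNIV. (LINT t|lborel. f j t))"
  proof -
    have "(LINT x|lborel. (\<Prod>j\<in>UNIV. f j ((x::real ^ 'd) $ j)))
        = (LINT g|(\<Pi>\<^sub>M b\<in>(Basis::(real^'d) set). lborel). (\<Prod>b\<in>Basis. h b (g b)))"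
      (is "?L = ?R")
    proof -
      have "?L = (LINT g|(\<Pi>\<^sub>M b\<in>(Basis::(real^'d) set). lborel). (\<Prod>j\<in>UNIV. f j ((\<Sum>b\<in>Basis. g b *\<^sub>R b) $ j)))"
        by (subst lborel_eq[where 'a = "real ^ 'd"], rule integral_distr) measurable
      then show ?thesis by (simp only: eq)
    qed
    also have "\<dots> = (\<Prod>b\<in>Basis. (LINT t|lborel. h b t))"
      by (intro lborel_product.product_integral_prod h_int) auto
    also have "\<dots> = (\<Prod>j\<in>UNIV. (LINT t|lborel. f j t))"
      by (simp add: prod_Basis_cart h)
    finally show ?thesis .
  qed
qed

lemma borel_measurable_vec_nth [measurable (raw)]:
  fixes f :: "'a \<Rightarrow> real ^ 'd"
  assumes [measurable]: "f \<in> borel_measurable M"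
  shows "(\<lambda>x. f x $ j) \<in> borel_measurable M"
  unfolding cart_eq_inner_axis by measurable

text \<open>Boxes form an intersection-stable generator of the Borel sets, so the two densities define the same
measure, and densities with respect to Lebesgue measure are unique.\<close>

lemma AE_lborel_eq_of_eq_on_boxes:
  fixes f g :: "'a::euclidean_space \<Rightarrow> real"
  assumes [measurable]: "f \<in> borel_measurable borel" "g \<in> borel_measurable borel"
    and nn: "\<And>x. 0 \<le> f x" "\<And>x. 0 \<le> g x"
    and int: "\<And>a b. set_integrable lborel (box a b) f" "\<And>a b. set_integrable lborel (box a b) g"
    and eq: "\<And>a b. (\<forall>i\<in>Basis. a \<bullet> i < b \<bullet> i) \<Longrightarrow>
               (LINT x:box a b|lborel. f x) = (LINT x:box a b|lborel. g x)"
  shows "AE x in lborel. f x = g x"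
proof -
  have em: "emeasure (density lborel (\<lambda>x. ennreal (h x))) (box a b) = ennreal (LINT x:box a b|lborel. h x)"
    if [measurable]: "h \<in> borel_measurable borel" and h: "\<And>x. 0 \<le> h x" "set_integrable lborel (box a b) h"
    for h :: "'a \<Rightarrow> real" and a b
  proof -
    have "emeasure (density lborel (\<lambda>x. ennreal (h x))) (box a b)
        = (\<integral>\<^sup>+x. ennreal (indicator (box a b) x *\<^sub>R h x) \<partial>lborel)"
      by (subst emeasure_density) (auto intro!: nn_integral_cong simp: indicator_def)
    also have "\<dots> = ennreal (LINT x:box a b|lborel. h x)"
      unfolding set_lebesgue_integral_def
      by (rule nn_integral_eq_integral) (use h in \<open>auto simp: set_integrable_def\<close>)
    finally show ?thesis .
  qed
  have eq': "emeasure (density lborel (\<lambda>x. ennreal (f x))) (box a b)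
      = emeasure (density lborel (\<lambda>x. ennreal (g x))) (box a b)" for a b
  proof (cases "box a b = {}")
    case False
    then show ?thesis by (simp add: em nn int eq box_ne_empty)
  qed simp
  have "density lborel (\<lambda>x. ennreal (f x)) = density lborel (\<lambda>x. ennreal (g x))"
  proof (rule measure_eqI_generator_eq)
    let ?E = "range (\<lambda>(a, b). box a b::'a set)"
    show "Int_stable ?E"
      by (auto simp: Int_stable_def box_Int_box)
    show "?E \<subseteq> Pow UNIV" "sets (density lborel (\<lambda>x. ennreal (f x))) = sigma_sets UNIV ?E"
      "sets (density lborel (\<lambda>x. ennreal (g x))) = sigma_sets UNIV ?E"
      by (simp_all add: borel_eq_box)
    let ?A = "\<lambda>n::nat. box (- (real n *\<^sub>R One)) (real n *\<^sub>R One) :: 'a set"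
    show "range ?A \<subseteq> ?E" "(\<Union>i. ?A i) = UNIV"
      unfolding UN_box_eq_UNIV by auto
    show "emeasure (density lborel (\<lambda>x. ennreal (f x))) (?A i) \<noteq> \<infinity>" for i
      by (simp add: em nn int)
    show "emeasure (density lborel (\<lambda>x. ennreal (f x))) X = emeasure (density lborel (\<lambda>x. ennreal (g x))) X"
      if "X \<in> ?E" for X
      using that eq' by auto
  qed
  then have "AE x in lborel. ennreal (f x) = ennreal (g x)"
    by (subst (asm) sigma_finite_measure.density_unique_iff[OF sigma_finite_lborel]) auto
  then show ?thesis
    by eventually_elim (use nn in auto)
qed

lemma continuous_on_open_eq_of_AE:
  fixes f g :: "'a::euclidean_space \<Rightarrow> real"
  assumes "open U" "continuous_on U f" "continuous_on U g" and ae: "AE x in lborel. f x = g x"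
    and "x \<in> U"
  shows "f x = g x"
proof -
  have "open {x\<in>U. f x \<noteq> g x}"
  proof -
    have "{x\<in>U. f x \<noteq> g x} = U \<inter> (\<lambda>x. f x - g x) -` (- {0})" by auto
    moreover have "open (U \<inter> (\<lambda>x. f x - g x) -` (- {0}))"
      using assms by (intro continuous_open_preimage continuous_intros) auto
    ultimately show ?thesis by simp
  qed
  show ?thesis
  proof (rule ccontr)
    assume "f x \<noteq> g x"
    then have ne: "{x\<in>U. f x \<noteq> g x} \<noteq> {}" using \<open>x \<in> U\<close> by auto
    have "AE x in lborel. x \<notin> {x\<in>U. f x \<noteq> g x}"
      using ae by eventually_elim auto
    then have "{x\<in>U. f x \<noteq> g x} \<in> null_sets lborel"
      using \<open>open {x\<in>U. f x \<noteq> g x}\<close> by (subst AE_iff_null_sets) auto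
    then show False
      using open_not_negligible[OF \<open>open {x\<in>U. f x \<noteq> g x}\<close> ne]
      by (auto simp: negligible_iff_null_sets null_sets_completionI)
  qed
qed

section \<open>Derivatives of the Fourier kernel\<close>

text \<open>The derivative of order \<open>k\<close> of \<open>fourier_kernel R\<close>. Each derivative of \<open>cos (s u)\<close> in \<open>u\<close> contributes
a factor \<open>s\<close> and a phase shift by \<open>pi / 2\<close>; in this form differentiation is just \<open>k \<mapsto> Suc k\<close> and the
singularity of \<open>sin (R u) / u\<close> at \<open>u = 0\<close> never appears.\<close>

definition kernel_deriv :: "nat \<Rightarrow> real \<Rightarrow> real \<Rightarrow> real" where
  "kernel_deriv k R u = integral {0..R} (\<lambda>s. s ^ k * cos (s * u + real k * (pi / 2)))"

lemma kernel_deriv_0: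
  assumes "R \<ge> 0"
  shows "kernel_deriv 0 R u = fourier_kernel R u"
proof (cases "u = 0")
  case True
  then show ?thesis using assms by (simp add: kernel_deriv_def fourier_kernel_def)
next
  case False
  have "((\<lambda>s. cos (s * u)) has_integral sin (R * u) / u - sin (0 * u) / u) {0..R}"
    using assms False
    by (intro fundamental_theorem_of_calculus)
       (auto intro!: derivative_eq_intros simp flip: has_real_derivative_iff_has_vector_derivative)
  then show ?thesis
    using False by (simp add: kernel_deriv_def fourier_kernel_def integral_unique)
qed

lemma DERIV_kernel_deriv: "DERIV (kernel_deriv k R) u :> kernel_deriv (Suc k) R u"
proof -
  have "((\<lambda>u. integral (cbox 0 R) (\<lambda>s. s ^ k * cos (s * u + real k * (pi / 2)))) has_field_derivative
         integral (cbox 0 R) (\<lambda>s. s ^ Suc k * cos (s * u + real (Suc k) * (pi / 2)))) (at u within UNIV)"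
  proof (rule leibniz_rule_field_derivative)
    fix u s :: real
    have "cos (s * u + real (Suc k) * (pi / 2)) = - sin (s * u + real k * (pi / 2))"
      using cos_add[of "s * u + real k * (pi / 2)" "pi / 2"] by (simp add: algebra_simps add_divide_distrib)
    then show "((\<lambda>u. s ^ k * cos (s * u + real k * (pi / 2))) has_field_derivative
         s ^ Suc k * cos (s * u + real (Suc k) * (pi / 2))) (at u within UNIV)"
      by (auto intro!: derivative_eq_intros)
  next
    show "(\<lambda>s. s ^ k * cos (s * u + real k * (pi / 2))) integrable_on cbox 0 R" for u
      by (intro integrable_continuous continuous_intros)
    show "continuous_on (UNIV \<times> cbox 0 R) (\<lambda>(u, s). s ^ Suc k * cos (s * u + real (Suc k) * (pi / 2)))"
      unfolding split_beta by (intro continuous_intros)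
  qed auto
  then show ?thesis by (simp add: kernel_deriv_def[abs_def])
qed

lemma continuous_on_kernel_deriv: "continuous_on A (kernel_deriv k R)"
  by (meson DERIV_kernel_deriv DERIV_continuous_on DERIV_subset subset_UNIV)

lemma borel_measurable_kernel_deriv [measurable]: "kernel_deriv k R \<in> borel_measurable borel"
  by (rule borel_measurable_continuous_onI) (rule continuous_on_kernel_deriv)

lemma integral_power_Icc:
  assumes "R \<ge> (0::real)"
  shows "integral {0..R} (\<lambda>s. real (Suc k) * s ^ k) = R ^ Suc k"
proof -
  have "((\<lambda>s. real (Suc k) * s ^ k) has_integral R ^ Suc k - 0 ^ Suc k) {0..R}"
    using assms
    using DERIV_power[OF DERIV_ident, of "Suc k"]
    by (intro fundamental_theorem_of_calculus)
       (auto simp flip: has_real_derivative_iff_has_vector_derivative intro: has_field_derivative_at_within)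
  then show ?thesis by (simp only: power_0_Suc diff_zero integral_unique)
qed

lemma abs_kernel_deriv_le_power:
  assumes "R \<ge> 0"
  shows "\<bar>kernel_deriv k R u\<bar> \<le> R ^ Suc k"
proof -
  have "norm (integral {0..R} (\<lambda>s. s ^ k * cos (s * u + real k * (pi / 2)))) \<le> R ^ k * (R - 0)"
  proof (rule integral_bound)
    show "norm (s ^ k * cos (s * u + real k * (pi / 2))) \<le> R ^ k" if "s \<in> {0..R}" for s
    proof -
      have "\<bar>s ^ k\<bar> * \<bar>cos (s * u + real k * (pi / 2))\<bar> \<le> R ^ k * 1"
        using that by (intro mult_mono) (auto intro!: power_mono)
      then show ?thesis by (simp add: abs_mult)
    qed
  qed (use assms in \<open>auto intro!: continuous_intros\<close>)
  then show ?thesis by (simp add: kernel_deriv_def mult.commute)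
qed

text \<open>Integration by parts in \<open>s\<close>: the boundary term and the remaining integral each contribute
\<open>R ^ k / \<bar>u\<bar>\<close>.\<close>

lemma abs_kernel_deriv_le_inverse:
  assumes "R \<ge> 0" "u \<noteq> 0"
  shows "\<bar>kernel_deriv k R u\<bar> \<le> 2 * R ^ k / \<bar>u\<bar>"
proof -
  let ?\<phi> = "\<lambda>s. s * u + real k * (pi / 2)"
  have *: "((\<lambda>s. s ^ k * cos (?\<phi> s) + real k * s ^ (k - 1) * sin (?\<phi> s) / u) has_integral
      R ^ k * sin (?\<phi> R) / u - 0 ^ k * sin (?\<phi> 0) / u) {0..R}"
    using assms
    by (intro fundamental_theorem_of_calculus)
       (auto intro!: derivative_eq_intros simp: field_simps
             simp flip: has_real_derivative_iff_has_vector_derivative)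
  \<comment> \<open>for \<open>k = 0\<close> the phase vanishes at \<open>s = 0\<close>, and otherwise the power does\<close>
  have zero: "0 ^ k * sin (?\<phi> 0) / u = 0" by (cases k) auto
  have eq: "kernel_deriv k R u + integral {0..R} (\<lambda>s. real k * s ^ (k - 1) * sin (?\<phi> s) / u)
      = R ^ k * sin (?\<phi> R) / u"
    unfolding kernel_deriv_def
    by (subst integral_add[symmetric])
       (use integral_unique[OF *] zero \<open>u \<noteq> 0\<close> in \<open>auto intro!: integrable_continuous_interval continuous_intros\<close>)
  have "\<bar>R ^ k * sin (?\<phi> R) / u\<bar> \<le> R ^ k / \<bar>u\<bar>"
    using assms by (auto simp: abs_mult divide_simps intro!: mult_left_le)
  moreover have "\<bar>integral {0..R} (\<lambda>s. real k * s ^ (k - 1) * sin (?\<phi> s) / u)\<bar> \<le> R ^ k / \<bar>u\<bar>"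
  proof (cases k)
    case 0
    then show ?thesis using assms by simp
  next
    case (Suc l)
    have "norm (integral {0..R} (\<lambda>s. real k * s ^ (k - 1) * sin (?\<phi> s) / u))
       \<le> integral {0..R} (\<lambda>s. real (Suc l) * s ^ l * (1 / \<bar>u\<bar>))"
    proof (rule integral_norm_bound_integral)
      show "norm (real k * s ^ (k - 1) * sin (?\<phi> s) / u) \<le> real (Suc l) * s ^ l * (1 / \<bar>u\<bar>)"
        if "s \<in> {0..R}" for s
      proof -
        have "\<bar>sin (?\<phi> s)\<bar> \<le> 1" by simp
        then have "(real k * s ^ l / \<bar>u\<bar>) * \<bar>sin (?\<phi> s)\<bar> \<le> (real k * s ^ l / \<bar>u\<bar>) * 1"
          using that by (intro mult_left_mono) auto
        then show ?thesis using that Suc by (simp add: abs_mult del: of_nat_Suc)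
      qed
    qed (use assms in \<open>auto intro!: integrable_continuous_interval continuous_intros\<close>)
    also have "\<dots> = R ^ k / \<bar>u\<bar>"
      using integral_power_Icc[OF \<open>R \<ge> 0\<close>, of l] Suc
      by (subst integral_mult_left) simp
    finally show ?thesis by simp
  qed
  ultimately show ?thesis using eq by linarith
qed

text \<open>Joins the bounds \<open>R ^ (k + 1)\<close> near the origin and \<open>2 R ^ k / \<bar>u\<bar>\<close> away from it into one
majorant with a known integral. The constant 5 makes \<open>min 1 (4 / v\<^sup>2) \<le> 5 / (1 + v\<^sup>2)\<close> for
\<open>v = R u\<close>.\<close>

lemma kernel_deriv_square_le:
  assumes "R > 0"
  shows "(kernel_deriv k R u)\<^sup>2 \<le> 5 * R ^ (2 * k + 2) * inverse (1 + (R * u)\<^sup>2)"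
proof (cases "\<bar>R * u\<bar> \<le> 2")
  case True
  have "(kernel_deriv k R u)\<^sup>2 \<le> (R ^ Suc k)\<^sup>2"
    using abs_kernel_deriv_le_power[of R k u] assms by (auto simp: abs_le_square_iff[symmetric])
  also have "\<dots> = R ^ (2 * k + 2) * 1" by (simp add: power2_eq_square power_add mult_2)
  also have "\<dots> \<le> R ^ (2 * k + 2) * (5 * inverse (1 + (R * u)\<^sup>2))"
  proof (intro mult_left_mono)
    have "(R * u)\<^sup>2 \<le> 2\<^sup>2" using True abs_le_square_iff[of "R * u" 2] by simp
    moreover have "0 < 1 + (R * u)\<^sup>2" by (simp add: add_pos_nonneg)
    ultimately show "1 \<le> 5 * inverse (1 + (R * u)\<^sup>2)" by (simp add: field_simps)
  qed (use assms in auto)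
  finally show ?thesis by (simp add: mult_ac)
next
  case False
  then have u: "u \<noteq> 0" by auto
  have ge: "2\<^sup>2 \<le> (R * u)\<^sup>2" using False abs_le_square_iff[of 2 "R * u"] by simp
  have "(kernel_deriv k R u)\<^sup>2 \<le> (2 * R ^ k / \<bar>u\<bar>)\<^sup>2"
    using abs_kernel_deriv_le_inverse[of R u k] assms u by (auto simp: abs_le_square_iff[symmetric])
  also have "\<dots> = (R ^ k)\<^sup>2 * R\<^sup>2 * (4 * inverse ((R * u)\<^sup>2))"
    using assms u by (simp add: power_divide power_mult_distrib divide_simps)
  also have "(R ^ k)\<^sup>2 * R\<^sup>2 = R ^ (2 * k + 2)"
    by (simp only: power_add power_even_eq)
  also have "R ^ (2 * k + 2) * (4 * inverse ((R * u)\<^sup>2)) \<le> R ^ (2 * k + 2) * (5 * inverse (1 + (R * u)\<^sup>2))"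
  proof (intro mult_left_mono)
    have "0 < 1 + (R * u)\<^sup>2" "0 < (R * u)\<^sup>2" using u assms by (simp_all add: add_pos_nonneg)
    then show "4 * inverse ((R * u)\<^sup>2) \<le> 5 * inverse (1 + (R * u)\<^sup>2)"
      using ge by (simp add: divide_simps)
  qed (use assms in auto)
  finally show ?thesis by (simp add: mult_ac)
qed

lemma
  assumes "R > 0"
  shows integrable_kernel_deriv_square: "integrable lborel (\<lambda>t. (kernel_deriv k R (x - t))\<^sup>2)"
    and integral_kernel_deriv_square_le:
      "(LINT t|lborel. (kernel_deriv k R (x - t))\<^sup>2) \<le> 5 * pi * R ^ (2 * k + 1)"
proof -
  have b: "has_bochner_integral lborel (\<lambda>x. inverse (1 + x\<^sup>2)) pi"
    using integrable_inverse_1_plus_square LBINT_inverse_1_plus_square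
    by (simp add: has_bochner_integral_iff set_integrable_def interval_lebesgue_integral_def set_lebesgue_integral_def)
  then have "has_bochner_integral lborel (\<lambda>t. inverse (1 + (R * x + (- R) * t)\<^sup>2)) (pi /\<^sub>R \<bar>- R\<bar>)"
    using assms by (intro lborel_has_bochner_integral_real_affine_iff[of "-R", THEN iffD1]) auto
  then have h: "has_bochner_integral lborel (\<lambda>t. 5 * R ^ (2 * k + 2) * inverse (1 + (R * (x - t))\<^sup>2))
      (5 * R ^ (2 * k + 2) * (pi / R))"
    using assms
    by (intro has_bochner_integral_mult_right) (simp add: algebra_simps divide_inverse)
  show int: "integrable lborel (\<lambda>t. (kernel_deriv k R (x - t))\<^sup>2)"
  proof (rule Bochner_Integration.integrable_bound[OF integrable.intros[OF h]])
    show "AE t in lborel. norm ((kernel_deriv k R (x - t))\<^sup>2)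
        \<le> norm (5 * R ^ (2 * k + 2) * inverse (1 + (R * (x - t))\<^sup>2))"
    proof (rule AE_I2)
      fix t
      show "norm ((kernel_deriv k R (x - t))\<^sup>2) \<le> norm (5 * R ^ (2 * k + 2) * inverse (1 + (R * (x - t))\<^sup>2))"
        using kernel_deriv_square_le[OF assms, of k "x - t"] zero_le_power2[of "kernel_deriv k R (x - t)"]
        unfolding real_norm_def by linarith
    qed
  qed measurable
  have "(LINT t|lborel. (kernel_deriv k R (x - t))\<^sup>2) \<le> (LINT t|lborel. 5 * R ^ (2 * k + 2) * inverse (1 + (R * (x - t))\<^sup>2))"
    by (intro integral_mono int integrable.intros[OF h] kernel_deriv_square_le assms)
  also have "\<dots> = 5 * pi * R ^ (2 * k + 1)"
    using has_bochner_integral_integral_eq[OF h] assms by (simp add: field_simps)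
  finally show "(LINT t|lborel. (kernel_deriv k R (x - t))\<^sup>2) \<le> 5 * pi * R ^ (2 * k + 1)" .
qed

lemma kernel_mode_eq_cis: "(\<i> * complex_of_real s) ^ k * exp (\<i> * complex_of_real (s * u))
   = complex_of_real (s ^ k) * cis (s * u + real k * (pi / 2))"
proof -
  have "\<i> ^ k = cis (real k * (pi / 2))"
    using Complex.DeMoivre[of "pi / 2" k] by (simp only: cis_pi_half)
  then show ?thesis
    by (simp add: power_mult_distrib cis_mult[symmetric] cis_conv_exp[of "s * u"])
qed

text \<open>Over the symmetric interval the frequencies \<open>s\<close> and \<open>- s\<close> contribute complex conjugates; they add up
to twice the real part, which is the integrand of \<open>kernel_deriv\<close>.\<close>

lemma
  assumes "R \<ge> 0"
  shows integrable_kernel_mode: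
     "set_integrable lborel {-R..R} (\<lambda>s. (\<i> * complex_of_real s) ^ k * exp (\<i> * complex_of_real (s * u)))"
  and integral_kernel_mode: "(LINT s:{-R..R}|lborel. (\<i> * complex_of_real s) ^ k * exp (\<i> * complex_of_real (s * u)))
    = complex_of_real (2 * kernel_deriv k R u)"
proof -
  let ?m = "\<lambda>s. (\<i> * complex_of_real s) ^ k * exp (\<i> * complex_of_real (s * u))"
  have cont: "continuous_on A ?m" for A by (intro continuous_intros)
  show int: "set_integrable lborel {-R..R} ?m"
    by (intro borel_integrable_atLeastAtMost' cont)
  have hk: "((\<lambda>s. s ^ k * cos (s * u + real k * (pi / 2))) has_integral kernel_deriv k R u) {0..R}"
    unfolding kernel_deriv_def
    by (intro integrable_integral integrable_continuous_interval continuous_intros)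
  have "(LINT s:{-R..R}|lborel. ?m s) = integral {-R..R} ?m"
    by (intro set_borel_integral_eq_integral int)
  also have "\<dots> = integral {-R..0} ?m + integral {0..R} ?m"
    using assms by (intro Henstock_Kurzweil_Integration.integral_combine[symmetric]
        integrable_continuous_interval cont) auto
  also have "integral {-R..0} ?m = integral {0..R} (\<lambda>s. ?m (- s))"
    using Henstock_Kurzweil_Integration.integral_reflect_real[of R 0 "\<lambda>s. ?m (- s)"] by simp
  also have "\<dots> + integral {0..R} ?m = integral {0..R} (\<lambda>s. ?m (- s) + ?m s)"
    by (intro integral_add[symmetric] integrable_continuous_interval continuous_intros)
  also have "(\<lambda>s. ?m (- s) + ?m s) = (\<lambda>s. complex_of_real (2 * (s ^ k * cos (s * u + real k * (pi / 2)))))"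
  proof
    fix s
    have cnj: "?m (- s) = cnj (?m s)"
      by (simp add: exp_cnj)
    show "?m (- s) + ?m s = complex_of_real (2 * (s ^ k * cos (s * u + real k * (pi / 2))))"
      unfolding cnj unfolding kernel_mode_eq_cis by (simp add: complex_eq_iff)
  qed
  also have "integral {0..R} \<dots> = complex_of_real (2 * kernel_deriv k R u)"
    by (intro integral_unique has_integral_of_real has_integral_mult_right hk)
  finally show "(LINT s:{-R..R}|lborel. ?m s) = complex_of_real (2 * kernel_deriv k R u)" .
qed

lemma partial_deriv_eqI:
  "((\<lambda>t. h (x + t *\<^sub>R axis j 1)) has_real_derivative D) (at 0) \<Longrightarrow> partial_deriv j h x = D"
  by (simp add: partial_deriv_def DERIV_imp_deriv)

lemma DERIV_kernel_deriv_prod: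
  fixes x y :: "real ^ 'd"
  shows "((\<lambda>t. \<Prod>l\<in>UNIV. kernel_deriv (count_list u l) R ((x + t *\<^sub>R axis j 1) $ l - y $ l)) has_real_derivative
     (\<Prod>l\<in>UNIV. kernel_deriv (count_list (j # u) l) R (x $ l - y $ l))) (at 0)"
proof -
  have split: "(\<Prod>l\<in>UNIV. f l) = f j * (\<Prod>l\<in>UNIV - {j}. f l)" for f :: "'d \<Rightarrow> real"
    by (rule prod.remove) auto
  have "((\<lambda>t. kernel_deriv (count_list u j) R (x $ j + t - y $ j)
          * (\<Prod>l\<in>UNIV - {j}. kernel_deriv (count_list u l) R (x $ l - y $ l))) has_real_derivative
        kernel_deriv (Suc (count_list u j)) R (x $ j + 0 - y $ j)
          * (\<Prod>l\<in>UNIV - {j}. kernel_deriv (count_list u l) R (x $ l - y $ l))) (at 0)"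
    by (auto intro!: derivative_eq_intros DERIV_chain2[OF DERIV_kernel_deriv])
  moreover have "(\<Prod>l\<in>UNIV. kernel_deriv (count_list u l) R ((x + t *\<^sub>R axis j 1) $ l - y $ l))
      = kernel_deriv (count_list u j) R (x $ j + t - y $ j)
          * (\<Prod>l\<in>UNIV - {j}. kernel_deriv (count_list u l) R (x $ l - y $ l))" for t
    unfolding split by (intro arg_cong2[of _ _ _ _ "(*)"] prod.cong) (auto simp: axis_def)
  moreover have "(\<Prod>l\<in>UNIV. kernel_deriv (count_list (j # u) l) R (x $ l - y $ l))
      = kernel_deriv (Suc (count_list u j)) R (x $ j + 0 - y $ j)
          * (\<Prod>l\<in>UNIV - {j}. kernel_deriv (count_list u l) R (x $ l - y $ l))"
    unfolding split by (intro arg_cong2[of _ _ _ _ "(*)"] prod.cong) auto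
  ultimately show ?thesis by simp
qed

lemma iter_partial_fourier_density_estimator:
  fixes x :: "real ^ 'd"
  assumes "R \<ge> 0"
  shows "iter_partial u (fourier_density_estimator n R obs) x =
    1 / (real n * pi ^ CARD('d)) * (\<Sum>k<n. \<Prod>l\<in>UNIV. kernel_deriv (count_list u l) R (x $ l - obs k $ l))"
proof (induction u arbitrary: x)
  case Nil
  show ?case using assms by (simp add: fourier_density_estimator_def kernel_deriv_0)
next
  case (Cons j u)
  have "partial_deriv j (iter_partial u (fourier_density_estimator n R obs)) x =
     1 / (real n * pi ^ CARD('d)) * (\<Sum>k<n. \<Prod>l\<in>UNIV. kernel_deriv (count_list (j # u) l) R (x $ l - obs k $ l))"
    unfolding Cons.IH[abs_def] ext[OF Cons.IH]
    by (intro partial_deriv_eqI DERIV_cmult DERIV_sum DERIV_kernel_deriv_prod)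
  then show ?case by simp
qed

section \<open>Means of the estimator as truncated Fourier integrals\<close>

text \<open>The derivative along the multi-index \<open>u\<close> of the plane wave \<open>x \<mapsto> exp (i s x)\<close>, written as a product over
coordinates so that its integral over a cube factorises.\<close>

definition fourier_mode :: "'d::finite list \<Rightarrow> real ^ 'd \<Rightarrow> real ^ 'd \<Rightarrow> complex" where
  "fourier_mode u x s =
     (\<Prod>j\<in>UNIV. (\<i> * complex_of_real (s $ j)) ^ count_list u j * exp (\<i> * complex_of_real (s $ j * x $ j)))"

definition abs_monomial :: "'d::finite list \<Rightarrow> real ^ 'd \<Rightarrow> real" where
  "abs_monomial u s = (\<Prod>j\<in>UNIV. \<bar>s $ j\<bar> ^ count_list u j)"

definition freq_box :: "real \<Rightarrow> (real ^ 'd) set" where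
  "freq_box R = {s. \<forall>j. \<bar>s $ j\<bar> \<le> R}"

lemma freq_box_measurable [measurable]: "freq_box R \<in> sets borel"
  unfolding freq_box_def by measurable

lemma indicator_freq_box: "(indicator (freq_box R) s :: real) = (\<Prod>j\<in>UNIV. indicator {-R..R} (s $ j))"
proof -
  have *: "(\<Prod>j\<in>UNIV. indicator {-R..R} (s $ j)) = (if \<forall>j. s $ j \<in> {-R..R} then 1 else (0::real))"
    by (auto simp: indicator_def split: if_splits)
  show ?thesis unfolding * by (auto simp: freq_box_def abs_le_iff indicator_def minus_le_iff)
qed

lemma norm_fourier_mode: "norm (fourier_mode u x s) = abs_monomial u s"
  unfolding fourier_mode_def abs_monomial_def
  by (simp add: norm_mult norm_power flip: prod_norm)

lemma abs_monomial_nonneg [simp]: "0 \<le> abs_monomial u s"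
  by (simp add: abs_monomial_def prod_nonneg)

lemma continuous_on_fourier_mode: "continuous_on A (fourier_mode u x)"
  unfolding fourier_mode_def by (intro continuous_intros)

lemma continuous_on_fourier_mode_left: "continuous_on A (\<lambda>x. fourier_mode u x s)"
  unfolding fourier_mode_def by (intro continuous_intros)

lemma borel_measurable_fourier_mode [measurable]: "fourier_mode u x \<in> borel_measurable borel"
  by (rule borel_measurable_continuous_onI) (rule continuous_on_fourier_mode)

lemma borel_measurable_abs_monomial [measurable]: "abs_monomial u \<in> borel_measurable borel"
  unfolding abs_monomial_def[abs_def] by measurable

lemma fourier_mode_add:
  "fourier_mode u (x + y) s = fourier_mode u x s * exp (\<i> * complex_of_real (s \<bullet> y))"
proof -
  have "exp (\<i> * complex_of_real (s \<bullet> y)) = (\<Prod>j\<in>UNIV. exp (\<i> * complex_of_real (s $ j * y $ j)))"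
    by (simp add: inner_vec_def sum_distrib_left exp_sum)
  then show ?thesis
    by (simp add: fourier_mode_def distrib_left exp_add mult.assoc flip: prod.distrib)
qed

lemma fourier_mode_diff:
  "fourier_mode u (x - y) s = fourier_mode u x s * exp (- \<i> * complex_of_real (s \<bullet> y))"
  using fourier_mode_add[of u x "- y" s] by simp

lemma fourier_mode_Cons:
  "fourier_mode (j # u) x s = \<i> * complex_of_real (s $ j) * fourier_mode u x s"
proof -
  have split: "(\<Prod>l\<in>UNIV. f l) = f j * (\<Prod>l\<in>UNIV - {j}. f l)" for f :: "'a \<Rightarrow> complex"
    by (rule prod.remove) auto
  have "(\<Prod>l\<in>UNIV - {j}. (\<i> * complex_of_real (s $ l)) ^ count_list (j # u) l * exp (\<i> * complex_of_real (s $ l * x $ l)))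
     = (\<Prod>l\<in>UNIV - {j}. (\<i> * complex_of_real (s $ l)) ^ count_list u l * exp (\<i> * complex_of_real (s $ l * x $ l)))"
    by (intro prod.cong) auto
  then show ?thesis
    unfolding fourier_mode_def split by simp
qed

lemma
  fixes x :: "real ^ 'd"
  assumes "R \<ge> 0"
  shows integrable_fourier_mode_freq_box:
      "integrable lborel (\<lambda>s. indicator (freq_box R) s *\<^sub>R fourier_mode u x s)"
    and integral_fourier_mode_freq_box:
      "(LINT s|lborel. indicator (freq_box R) s *\<^sub>R fourier_mode u x s)
        = complex_of_real (2 ^ CARD('d) * (\<Prod>j\<in>UNIV. kernel_deriv (count_list u j) R (x $ j)))"
proof -
  define f where "f j t = indicator {-R..R} t *\<^sub>R
      ((\<i> * complex_of_real t) ^ count_list u j * exp (\<i> * complex_of_real (t * x $ j)))" for j t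
  have f: "integrable lborel (f j)" for j
    using integrable_kernel_mode[OF assms] by (simp add: set_integrable_def f_def[abs_def])
  have eq: "indicator (freq_box R) s *\<^sub>R fourier_mode u x s = (\<Prod>j\<in>UNIV. f j (s $ j))" for s
    by (simp add: indicator_freq_box fourier_mode_def f_def scaleR_conv_of_real prod.distrib)
  show "integrable lborel (\<lambda>s. indicator (freq_box R) s *\<^sub>R fourier_mode u x s)"
    unfolding eq by (rule integrable_lborel_cart_prod[OF f])
  have "(LINT s|lborel. indicator (freq_box R) s *\<^sub>R fourier_mode u x s) = (\<Prod>j\<in>UNIV. (LINT t|lborel. f j t))"
    unfolding eq by (rule integral_lborel_cart_prod[OF f])
  also have "\<dots> = (\<Prod>j\<in>UNIV. complex_of_real (2 * kernel_deriv (count_list u j) R (x $ j)))"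
    using integral_kernel_mode[OF assms] by (simp add: set_lebesgue_integral_def f_def)
  finally show "(LINT s|lborel. indicator (freq_box R) s *\<^sub>R fourier_mode u x s)
        = complex_of_real (2 ^ CARD('d) * (\<Prod>j\<in>UNIV. kernel_deriv (count_list u j) R (x $ j)))"
    by (simp add: prod.distrib)
qed

lemma norm_exp_i_real [simp]: "norm (exp (- (\<i> * complex_of_real a))) = 1"
  using norm_exp_i_times[of "-a"] by simp

lemma borel_measurable_fourier_transform [measurable]:
  assumes [measurable]: "p \<in> borel_measurable borel"
  shows "fourier_transform p \<in> borel_measurable borel"
  unfolding fourier_transform_def[abs_def] by measurable

text \<open>The product of the kernels is, up to the factor \<open>2 ^ d\<close>, the integral of \<open>fourier_mode u (x - y)\<close>
over the cube of frequencies. Its dependence on \<open>y\<close> is the factor \<open>exp (- i s y)\<close>, so that after exchanging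
the integrals the one over \<open>y\<close> is the Fourier transform. The exchange is legitimate since the cube is bounded
and \<open>p\<close> integrable.\<close>

lemma integral_kernel_deriv_eq_fourier:
  fixes p :: "real ^ 'd \<Rightarrow> real"
  assumes p: "integrable lborel p" and "R \<ge> 0"
  shows "complex_of_real (LINT y|lborel. p y * (\<Prod>j\<in>UNIV. kernel_deriv (count_list u j) R (x $ j - y $ j)))
    = (LINT s|lborel. indicator (freq_box R) s *\<^sub>R (fourier_mode u x s * fourier_transform p s)) / 2 ^ CARD('d)"
proof -
  have [measurable]: "p \<in> borel_measurable borel"
    using borel_measurable_integrable[OF p] by simp
  define F where "F s y = indicator (freq_box R) s *\<^sub>R
      (fourier_mode u x s * (complex_of_real (p y) * exp (- \<i> * complex_of_real (s \<bullet> y))))" for s y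
  have p_int: "integrable lborel (\<lambda>y. complex_of_real (p y) * exp (- \<i> * complex_of_real (s \<bullet> y)))" for s
    by (rule Bochner_Integration.integrable_bound[OF integrable_abs[OF p]]) (auto simp: norm_mult)
  have int: "integrable (lborel \<Otimes>\<^sub>M lborel) (case_prod F)"
  proof (rule lborel_pair.Fubini_integrable)
    show "case_prod F \<in> borel_measurable (lborel \<Otimes>\<^sub>M lborel)"
      unfolding F_def by measurable
    have "(\<lambda>s. LINT y|lborel. norm (case_prod F (s, y)))
        = (\<lambda>s. norm (indicator (freq_box R) s *\<^sub>R fourier_mode u x s) * (LINT y|lborel. \<bar>p y\<bar>))"
      by (simp add: F_def norm_mult mult.assoc)
    then show "integrable lborel (\<lambda>s. LINT y|lborel. norm (case_prod F (s, y)))"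
      using integrable_norm[OF integrable_fourier_mode_freq_box[OF \<open>R \<ge> 0\<close>, of u x]] by simp
    show "AE s in lborel. integrable lborel (\<lambda>y. case_prod F (s, y))"
      using p_int unfolding F_def by auto
  qed
  have "complex_of_real (LINT y|lborel. p y * (\<Prod>j\<in>UNIV. kernel_deriv (count_list u j) R (x $ j - y $ j))) * 2 ^ CARD('d)
      = (LINT y|lborel. complex_of_real (p y) * complex_of_real (2 ^ CARD('d) * (\<Prod>j\<in>UNIV. kernel_deriv (count_list u j) R ((x - y) $ j))))"
  proof -
    have "(LINT y|lborel. p y * (\<Prod>j\<in>UNIV. kernel_deriv (count_list u j) R (x $ j - y $ j))) * 2 ^ CARD('d)
      = (LINT y|lborel. p y * (2 ^ CARD('d) * (\<Prod>j\<in>UNIV. kernel_deriv (count_list u j) R ((x - y) $ j))))"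
      by (simp add: mult.left_commute[of _ "2 ^ CARD('d)"] mult.commute[of _ "2 ^ CARD('d)"])
    then have "complex_of_real ((LINT y|lborel. p y * (\<Prod>j\<in>UNIV. kernel_deriv (count_list u j) R (x $ j - y $ j))) * 2 ^ CARD('d))
      = (LINT y|lborel. complex_of_real (p y * (2 ^ CARD('d) * (\<Prod>j\<in>UNIV. kernel_deriv (count_list u j) R ((x - y) $ j)))))"
      by (simp only: integral_complex_of_real)
    then show ?thesis by (simp only: of_real_mult of_real_power of_real_numeral)
  qed
  also have "\<dots> = (LINT y|lborel. (LINT s|lborel. F s y))"
  proof (rule Bochner_Integration.integral_cong[OF refl])
    fix y
    have "complex_of_real (p y) * (LINT s|lborel. indicator (freq_box R) s *\<^sub>R fourier_mode u (x - y) s)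
       = (LINT s|lborel. complex_of_real (p y) * (indicator (freq_box R) s *\<^sub>R fourier_mode u (x - y) s))"
      by (rule integral_mult_right_zero[symmetric])
    also have "\<dots> = (LINT s|lborel. F s y)"
      by (intro Bochner_Integration.integral_cong refl) (simp add: F_def fourier_mode_diff mult_ac)
    finally show "complex_of_real (p y) * complex_of_real (2 ^ CARD('d) * (\<Prod>j\<in>UNIV. kernel_deriv (count_list u j) R ((x - y) $ j)))
        = (LINT s|lborel. F s y)"
      unfolding integral_fourier_mode_freq_box[OF \<open>R \<ge> 0\<close>] .
  qed
  also have "\<dots> = (LINT s|lborel. (LINT y|lborel. F s y))"
    by (rule lborel_pair.Fubini_integral[OF int])
  also have "\<dots> = (LINT s|lborel. indicator (freq_box R) s *\<^sub>R (fourier_mode u x s * fourier_transform p s))"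
    by (simp add: F_def fourier_transform_def)
  finally show ?thesis by (simp add: field_simps)
qed

section \<open>The inverse Fourier integral and its derivatives\<close>

text \<open>The derivative along \<open>u\<close> of the inverse Fourier integral of \<open>p\<close>, by formal differentiation under the
integral sign. Taking the real part keeps it in the type of \<open>p\<close>; the imaginary part would vanish.\<close>

definition fourier_inverse_deriv :: "(real ^ 'd \<Rightarrow> real) \<Rightarrow> 'd list \<Rightarrow> real ^ 'd \<Rightarrow> real" where
  "fourier_inverse_deriv p u x =
     Re (LINT s|lborel. fourier_mode u x s * fourier_transform p s) / (2 * pi) ^ CARD('d)"

definition finite_fourier_moment :: "(real ^ 'd \<Rightarrow> real) \<Rightarrow> 'd list \<Rightarrow> bool" where
  "finite_fourier_moment p u \<longleftrightarrow> integrable lborel (\<lambda>s. abs_monomial u s * cmod (fourier_transform p s))"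

lemma integrable_fourier_mode_transform:
  fixes p :: "real ^ 'd \<Rightarrow> real"
  assumes [measurable]: "p \<in> borel_measurable borel" and "finite_fourier_moment p u"
  shows "integrable lborel (\<lambda>s. fourier_mode u x s * fourier_transform p s)"
  by (rule Bochner_Integration.integrable_bound[OF assms(2)[unfolded finite_fourier_moment_def]])
     (auto simp: norm_mult norm_fourier_mode)

lemma fourier_inverse_deriv_bound:
  fixes p :: "real ^ 'd \<Rightarrow> real"
  assumes [measurable]: "p \<in> borel_measurable borel" and "finite_fourier_moment p u"
  shows "\<bar>fourier_inverse_deriv p u x\<bar> \<le>
    (LINT s|lborel. abs_monomial u s * cmod (fourier_transform p s)) / (2 * pi) ^ CARD('d)"
proof -
  have "\<bar>Re (LINT s|lborel. fourier_mode u x s * fourier_transform p s)\<bar>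
     \<le> norm (LINT s|lborel. fourier_mode u x s * fourier_transform p s)"
    by (rule abs_Re_le_cmod)
  also have "\<dots> \<le> (LINT s|lborel. norm (fourier_mode u x s * fourier_transform p s))"
    by (rule integral_norm_bound)
  also have "\<dots> = (LINT s|lborel. abs_monomial u s * cmod (fourier_transform p s))"
    by (simp add: norm_mult norm_fourier_mode)
  finally show ?thesis
    by (simp add: fourier_inverse_deriv_def abs_div divide_right_mono)
qed

lemma continuous_on_fourier_inverse_deriv:
  fixes p :: "real ^ 'd \<Rightarrow> real"
  assumes [measurable]: "p \<in> borel_measurable borel" and "finite_fourier_moment p u"
  shows "continuous_on A (fourier_inverse_deriv p u)"
proof (rule continuous_on_sequentiallyI)
  fix X :: "nat \<Rightarrow> real ^ 'd" and x assume "X \<longlonglongrightarrow> x"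
  have "(\<lambda>n. LINT s|lborel. fourier_mode u (X n) s * fourier_transform p s) \<longlonglongrightarrow>
      (LINT s|lborel. fourier_mode u x s * fourier_transform p s)"
  proof (rule integral_dominated_convergence)
    show "integrable lborel (\<lambda>s. abs_monomial u s * cmod (fourier_transform p s))"
      using assms(2) by (simp add: finite_fourier_moment_def)
    show "AE s in lborel. (\<lambda>n. fourier_mode u (X n) s * fourier_transform p s)
        \<longlonglongrightarrow> fourier_mode u x s * fourier_transform p s"
    proof (rule AE_I2)
      fix s
      have "isCont (\<lambda>x. fourier_mode u x s) x"
        using continuous_on_fourier_mode_left[of UNIV u s] by (simp add: continuous_on_eq_continuous_at)
      then show "(\<lambda>n. fourier_mode u (X n) s * fourier_transform p s)
        \<longlonglongrightarrow> fourier_mode u x s * fourier_transform p s"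
        using \<open>X \<longlonglongrightarrow> x\<close> by (auto intro: tendsto_mult_right isCont_tendsto_compose[of x "\<lambda>x. fourier_mode u x s"])
    qed
  qed (auto simp: norm_mult norm_fourier_mode)
  then show "(\<lambda>n. fourier_inverse_deriv p u (X n)) \<longlonglongrightarrow> fourier_inverse_deriv p u x"
    unfolding fourier_inverse_deriv_def by (intro tendsto_intros) auto
qed

text \<open>By the mean value theorem a bound on the derivative bounds all difference quotients, so dominated
convergence applies to them.\<close>

lemma DERIV_integral_dominated:
  fixes F :: "real \<Rightarrow> 'a \<Rightarrow> real"
  assumes F: "\<And>t. integrable M (F t)"
    and deriv: "\<And>t s. s \<in> space M \<Longrightarrow> DERIV (\<lambda>t. F t s) t :> F' t s"
    and bound: "\<And>t s. s \<in> space M \<Longrightarrow> \<bar>F' t s\<bar> \<le> B s"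
    and B: "integrable M B" and meas: "F' t0 \<in> borel_measurable M"
  shows "DERIV (\<lambda>t. LINT s|M. F t s) t0 :> (LINT s|M. F' t0 s)"
  unfolding DERIV_def tendsto_at_iff_sequentially comp_def
proof (intro allI impI)
  fix H :: "nat \<Rightarrow> real" assume H: "\<forall>n. H n \<in> UNIV - {0}" "H \<longlonglongrightarrow> 0"
  have [measurable]: "F t \<in> borel_measurable M" for t
    using F by auto
  have "(\<lambda>n. LINT s|M. (F (t0 + H n) s - F t0 s) / H n) \<longlonglongrightarrow> (LINT s|M. F' t0 s)"
  proof (rule integral_dominated_convergence[OF meas _ B])
    show "AE s in M. (\<lambda>n. (F (t0 + H n) s - F t0 s) / H n) \<longlonglongrightarrow> F' t0 s"
    proof (rule AE_I2)
      fix s assume "s \<in> space M"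
      then show "(\<lambda>n. (F (t0 + H n) s - F t0 s) / H n) \<longlonglongrightarrow> F' t0 s"
        using deriv[of s t0] H unfolding DERIV_def tendsto_at_iff_sequentially comp_def by blast
    qed
    show "AE s in M. norm ((F (t0 + H n) s - F t0 s) / H n) \<le> B s" for n
    proof (rule AE_I2)
      fix s assume s: "s \<in> space M"
      have "norm (F (t0 + H n) s - F t0 s) \<le> B s * norm (t0 + H n - t0)"
        by (rule field_differentiable_bound[of UNIV "\<lambda>t. F t s" "\<lambda>t. F' t s"])
           (use deriv[OF s] bound[OF s] in auto)
      moreover have "H n \<noteq> 0" using H by auto
      ultimately show "norm ((F (t0 + H n) s - F t0 s) / H n) \<le> B s"
        by (simp add: divide_le_eq)
    qed
  qed measurable
  then show "(\<lambda>n. ((LINT s|M. F (t0 + H n) s) - (LINT s|M. F t0 s)) / H n) \<longlonglongrightarrow> (LINT s|M. F' t0 s)"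
    by (simp add: F)
qed

lemma DERIV_fourier_inverse_deriv:
  fixes p :: "real ^ 'd \<Rightarrow> real"
  assumes [measurable]: "p \<in> borel_measurable borel"
    and "finite_fourier_moment p u" "finite_fourier_moment p (j # u)"
  shows "DERIV (\<lambda>t. fourier_inverse_deriv p u (x + t *\<^sub>R axis j 1)) 0 :> fourier_inverse_deriv p (j # u) x"
proof -
  note int = integrable_fourier_mode_transform[OF assms(1)]
  have Re_int: "Re (LINT s|lborel. f s) = (LINT s|lborel. Re (f s))" if "integrable lborel f"
    for f :: "real ^ 'd \<Rightarrow> complex"
    using integral_Re[OF that] by simp
  have "DERIV (\<lambda>t. LINT s|lborel. Re (fourier_mode u (x + t *\<^sub>R axis j 1) s * fourier_transform p s)) 0
     :> (LINT s|lborel. Re (fourier_mode (j # u) (x + 0 *\<^sub>R axis j 1) s * fourier_transform p s))"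
  proof (rule DERIV_integral_dominated)
    fix t :: real and s :: "real ^ 'd"
    have "((\<lambda>t. exp (\<i> * complex_of_real t * complex_of_real (s $ j))) has_vector_derivative
        \<i> * complex_of_real (s $ j) * exp (\<i> * complex_of_real t * complex_of_real (s $ j))) (at t)"
      by (rule has_vector_derivative_real_field) (auto intro!: derivative_eq_intros)
    then have "((\<lambda>t. fourier_mode u x s * exp (\<i> * complex_of_real t * complex_of_real (s $ j)) * fourier_transform p s) has_vector_derivative
        fourier_mode u x s * (\<i> * complex_of_real (s $ j) * exp (\<i> * complex_of_real t * complex_of_real (s $ j))) * fourier_transform p s) (at t)"
      by (intro has_vector_derivative_mult_left has_vector_derivative_mult_right)
    then have "((\<lambda>t. fourier_mode u (x + t *\<^sub>R axis j 1) s * fourier_transform p s) has_vector_derivative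
        fourier_mode (j # u) (x + t *\<^sub>R axis j 1) s * fourier_transform p s) (at t)"
      by (simp add: fourier_mode_Cons fourier_mode_add inner_axis mult_ac)
    then show "DERIV (\<lambda>t. Re (fourier_mode u (x + t *\<^sub>R axis j 1) s * fourier_transform p s)) t
        :> Re (fourier_mode (j # u) (x + t *\<^sub>R axis j 1) s * fourier_transform p s)"
      unfolding has_real_derivative_iff_has_vector_derivative
      by (rule bounded_linear.has_vector_derivative[OF bounded_linear_Re])
    show "\<bar>Re (fourier_mode (j # u) (x + t *\<^sub>R axis j 1) s * fourier_transform p s)\<bar>
        \<le> abs_monomial (j # u) s * cmod (fourier_transform p s)"
      using abs_Re_le_cmod[of "fourier_mode (j # u) (x + t *\<^sub>R axis j 1) s * fourier_transform p s"]
      by (simp only: norm_mult norm_fourier_mode)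
  next
    show "integrable lborel (\<lambda>s. abs_monomial (j # u) s * cmod (fourier_transform p s))"
      using assms(3) by (simp add: finite_fourier_moment_def)
    show "integrable lborel (\<lambda>s. Re (fourier_mode u (x + t *\<^sub>R axis j 1) s * fourier_transform p s))" for t
      by (intro integrable_Re int assms)
  qed measurable
  then have "DERIV (\<lambda>t. (LINT s|lborel. Re (fourier_mode u (x + t *\<^sub>R axis j 1) s * fourier_transform p s)) / (2 * pi) ^ CARD('d)) 0
     :> (LINT s|lborel. Re (fourier_mode (j # u) (x + 0 *\<^sub>R axis j 1) s * fourier_transform p s)) / (2 * pi) ^ CARD('d)"
    by (rule DERIV_cdivide)
  then show ?thesis
    unfolding fourier_inverse_deriv_def by (simp add: Re_int int assms)
qed

text \<open>A partial derivative at a point of \<open>U\<close> sees only values in \<open>U\<close>, so the identity propagates from one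
order of differentiation to the next.\<close>

lemma iter_partial_eq_fourier_inverse_deriv:
  fixes p :: "real ^ 'd \<Rightarrow> real"
  assumes [measurable]: "p \<in> borel_measurable borel"
    and mom: "\<And>u. length u \<le> r \<Longrightarrow> finite_fourier_moment p u"
    and U: "open U" and eq: "\<And>x. x \<in> U \<Longrightarrow> p x = fourier_inverse_deriv p [] x"
    and "length u \<le> r" "x \<in> U"
  shows "iter_partial u p x = fourier_inverse_deriv p u x"
  using assms(5,6)
proof (induction u arbitrary: x)
  case Nil
  then show ?case by (simp add: eq)
next
  case (Cons j u)
  have "((\<lambda>t. x + t *\<^sub>R axis j 1) \<longlongrightarrow> x + 0 *\<^sub>R axis j 1) (at 0)"
    by (intro tendsto_intros)
  then have "\<forall>\<^sub>F t in at 0. x + t *\<^sub>R axis j 1 \<in> U"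
    using U Cons.prems by (intro topological_tendstoD) auto
  then have "\<forall>\<^sub>F t in nhds 0. x + t *\<^sub>R axis j 1 \<in> U"
    using Cons.prems by (simp add: eventually_nhds_conv_at)
  then have ev: "\<forall>\<^sub>F t in nhds 0. iter_partial u p (x + t *\<^sub>R axis j 1)
      = fourier_inverse_deriv p u (x + t *\<^sub>R axis j 1)"
    by eventually_elim (use Cons in auto)
  have "DERIV (\<lambda>t. iter_partial u p (x + t *\<^sub>R axis j 1)) 0 :> fourier_inverse_deriv p (j # u) x"
    using DERIV_fourier_inverse_deriv[OF assms(1), of u j x] mom Cons.prems
    by (subst DERIV_cong_ev[OF refl ev refl]) auto
  then show ?case by (simp add: partial_deriv_eqI)
qed

text \<open>Here \<open>G R x\<close> is the mean of the differentiated estimator. All three claims compare the Fourier integral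
over the cube with the one over the whole space: the cube exhausts the space, and the difference is the
integral over the complement of the cube.\<close>

lemma
  fixes p :: "real ^ 'd \<Rightarrow> real"
  assumes p: "integrable lborel p" and mom: "finite_fourier_moment p u"
  defines "G \<equiv> \<lambda>R x. (LINT y|lborel. p y * (\<Prod>j\<in>UNIV. kernel_deriv (count_list u j) R (x $ j - y $ j))) / pi ^ CARD('d)"
  shows kernel_smoothing_tendsto_fourier_inverse:
      "(\<lambda>n. G (real n) x) \<longlonglongrightarrow> fourier_inverse_deriv p u x"
    and kernel_smoothing_fourier_tail: "R \<ge> 0 \<Longrightarrow> \<bar>G R x - fourier_inverse_deriv p u x\<bar>
      \<le> (LINT s|lborel. indicator (- freq_box R) s * (abs_monomial u s * cmod (fourier_transform p s))) / (2 * pi) ^ CARD('d)"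
    and kernel_smoothing_bound: "R \<ge> 0 \<Longrightarrow> \<bar>G R x\<bar>
      \<le> (LINT s|lborel. abs_monomial u s * cmod (fourier_transform p s)) / (2 * pi) ^ CARD('d)"
proof -
  have [measurable]: "p \<in> borel_measurable borel"
    using borel_measurable_integrable[OF p] by simp
  let ?f = "\<lambda>s. fourier_mode u x s * fourier_transform p s"
  let ?a = "\<lambda>s. abs_monomial u s * cmod (fourier_transform p s)"
  have a_int: "integrable lborel ?a" using mom by (simp add: finite_fourier_moment_def)
  have f_int: "integrable lborel ?f" by (rule integrable_fourier_mode_transform) (use mom in auto)
  have ind_int: "integrable lborel (\<lambda>s. indicator A s *\<^sub>R ?f s)" if [measurable]: "A \<in> sets borel" for A
    using f_int by (intro integrable_mult_indicator) auto
  have ind_a: "integrable lborel (\<lambda>s. indicator A s * ?a s)" if [measurable]: "A \<in> sets borel" for A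
    using integrable_mult_indicator[OF _ a_int, of A] by auto
  have G: "G R x = Re (LINT s|lborel. indicator (freq_box R) s *\<^sub>R ?f s) / (2 * pi) ^ CARD('d)"
    if "R \<ge> 0" for R
  proof -
    have "(LINT y|lborel. p y * (\<Prod>j\<in>UNIV. kernel_deriv (count_list u j) R (x $ j - y $ j)))
       = Re ((LINT s|lborel. indicator (freq_box R) s *\<^sub>R ?f s) / 2 ^ CARD('d))"
      by (subst integral_kernel_deriv_eq_fourier[OF p that, symmetric]) simp
    also have "\<dots> = Re (LINT s|lborel. indicator (freq_box R) s *\<^sub>R ?f s) / 2 ^ CARD('d)"
    proof -
      have two: "(2 :: complex) ^ CARD('d) = complex_of_real (2 ^ CARD('d))" by simp
      show ?thesis unfolding two by (rule Re_divide_of_real)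
    qed
    finally show ?thesis by (simp add: G_def power_mult_distrib)
  qed
  have "(\<lambda>n. LINT s|lborel. indicator (freq_box (real n)) s *\<^sub>R ?f s) \<longlonglongrightarrow> (LINT s|lborel. ?f s)"
  proof (rule integral_dominated_convergence[OF _ _ a_int])
    show "AE s in lborel. (\<lambda>n. indicator (freq_box (real n)) s *\<^sub>R ?f s) \<longlonglongrightarrow> ?f s"
    proof (rule AE_I2)
      fix s :: "real ^ 'd"
      have "\<forall>\<^sub>F n in sequentially. \<forall>j\<in>UNIV. \<bar>s $ j\<bar> \<le> real n"
        by (subst eventually_ball_finite_distrib)
           (auto intro: eventually_mono[OF eventually_ge_at_top[of "nat \<lceil>\<bar>s $ j\<bar>\<rceil>" for j]])
      then have "\<forall>\<^sub>F n in sequentially. indicator (freq_box (real n)) s *\<^sub>R ?f s = ?f s"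
        by eventually_elim (auto simp: freq_box_def)
      then show "(\<lambda>n. indicator (freq_box (real n)) s *\<^sub>R ?f s) \<longlonglongrightarrow> ?f s"
        by (rule tendsto_eventually)
    qed
    show "AE s in lborel. norm (indicator (freq_box (real n)) s *\<^sub>R ?f s) \<le> ?a s" for n
      by (auto simp: norm_mult norm_fourier_mode indicator_def)
  qed measurable
  then show "(\<lambda>n. G (real n) x) \<longlonglongrightarrow> fourier_inverse_deriv p u x"
    unfolding fourier_inverse_deriv_def by (simp add: G) (intro tendsto_intros; simp)
  { assume "R \<ge> 0"
    have "(LINT s|lborel. ?f s) = (LINT s|lborel. indicator (freq_box R) s *\<^sub>R ?f s + indicator (- freq_box R) s *\<^sub>R ?f s)"
      by (intro Bochner_Integration.integral_cong) (auto simp: indicator_def)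
    also have "\<dots> = (LINT s|lborel. indicator (freq_box R) s *\<^sub>R ?f s) + (LINT s|lborel. indicator (- freq_box R) s *\<^sub>R ?f s)"
      by (intro Bochner_Integration.integral_add ind_int) measurable
    finally have "G R x - fourier_inverse_deriv p u x = - Re (LINT s|lborel. indicator (- freq_box R) s *\<^sub>R ?f s) / (2 * pi) ^ CARD('d)"
      by (simp add: G \<open>R \<ge> 0\<close> fourier_inverse_deriv_def add_divide_distrib)
    then have "\<bar>G R x - fourier_inverse_deriv p u x\<bar> = \<bar>Re (LINT s|lborel. indicator (- freq_box R) s *\<^sub>R ?f s)\<bar> / (2 * pi) ^ CARD('d)"
      by simp
    also have "\<dots> \<le> norm (LINT s|lborel. indicator (- freq_box R) s *\<^sub>R ?f s) / (2 * pi) ^ CARD('d)"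
      by (intro divide_right_mono abs_Re_le_cmod) simp
    also have "\<dots> \<le> (LINT s|lborel. norm (indicator (- freq_box R) s *\<^sub>R ?f s)) / (2 * pi) ^ CARD('d)"
      by (intro divide_right_mono integral_norm_bound) simp
    also have "\<dots> = (LINT s|lborel. indicator (- freq_box R) s * ?a s) / (2 * pi) ^ CARD('d)"
      by (simp add: norm_mult norm_fourier_mode)
    finally show "\<bar>G R x - fourier_inverse_deriv p u x\<bar>
      \<le> (LINT s|lborel. indicator (- freq_box R) s * ?a s) / (2 * pi) ^ CARD('d)" . }
  { assume "R \<ge> 0"
    then have "\<bar>G R x\<bar> = \<bar>Re (LINT s|lborel. indicator (freq_box R) s *\<^sub>R ?f s)\<bar> / (2 * pi) ^ CARD('d)"
      by (simp add: G)
    also have "\<dots> \<le> norm (LINT s|lborel. indicator (freq_box R) s *\<^sub>R ?f s) / (2 * pi) ^ CARD('d)"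
      by (intro divide_right_mono abs_Re_le_cmod) simp
    also have "\<dots> \<le> (LINT s|lborel. norm (indicator (freq_box R) s *\<^sub>R ?f s)) / (2 * pi) ^ CARD('d)"
      by (intro divide_right_mono integral_norm_bound) simp
    also have "\<dots> \<le> (LINT s|lborel. ?a s) / (2 * pi) ^ CARD('d)"
      by (intro divide_right_mono integral_mono a_int integrable_norm ind_int)
         (auto simp: norm_mult norm_fourier_mode indicator_def)
    finally show "\<bar>G R x\<bar> \<le> (LINT s|lborel. ?a s) / (2 * pi) ^ CARD('d)" . }
qed

section \<open>Fourier inversion for densities\<close>

lemma
  assumes "R > 0" "a \<le> b"
  shows integrable_fourier_kernel_Ioo: "set_integrable lborel {a<..<b} (\<lambda>t. fourier_kernel R (t - y))"
    and integral_fourier_kernel_Ioo: "(LINT t:{a<..<b}|lborel. fourier_kernel R (t - y)) = Si (R * (b - y)) - Si (R * (a - y))"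
proof -
  have cont: "continuous_on A (\<lambda>t. fourier_kernel R (t - y))" for A
  proof -
    have eq: "fourier_kernel R = kernel_deriv 0 R" using kernel_deriv_0[of R] assms by auto
    show ?thesis unfolding eq
      by (rule continuous_on_compose2[OF continuous_on_kernel_deriv[of UNIV]]) (auto intro!: continuous_intros)
  qed
  show int: "set_integrable lborel {a<..<b} (\<lambda>t. fourier_kernel R (t - y))"
    by (rule set_integrable_subset[OF borel_integrable_atLeastAtMost'[OF cont, of a b]]) auto
  have "(LINT t:{a<..<b}|lborel. fourier_kernel R (t - y)) = (LBINT t=a..b. fourier_kernel R (t - y))"
    using assms by (simp add: interval_integral_Ioo)
  also have "\<dots> = Si (R * (b - y)) - Si (R * (a - y))"
  proof (rule interval_integral_FTC_finite[OF cont])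
    fix t
    have "DERIV (\<lambda>t. Si (R * (t - y))) t :> sinc (R * (t - y)) * R"
      by (rule DERIV_chain2[OF DERIV_Si]) (auto intro!: derivative_eq_intros)
    moreover have "sinc (R * (t - y)) * R = fourier_kernel R (t - y)"
      using \<open>R > 0\<close> by (simp add: fourier_kernel_def)
    ultimately show "((\<lambda>t. Si (R * (t - y))) has_vector_derivative fourier_kernel R (t - y)) (at t within {min a b..max a b})"
      by (auto simp flip: has_real_derivative_iff_has_vector_derivative intro: has_field_derivative_at_within)
  qed
  finally show "(LINT t:{a<..<b}|lborel. fourier_kernel R (t - y)) = Si (R * (b - y)) - Si (R * (a - y))" .
qed

lemma Si_scaled_tendsto:
  assumes "c \<noteq> 0"
  shows "(\<lambda>n. Si (real (Suc n) * c)) \<longlonglongrightarrow> sgn c * (pi / 2)"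
proof -
  have pos: "(\<lambda>n. Si (real (Suc n) * c)) \<longlonglongrightarrow> pi / 2" if "c > 0" for c
  proof -
    have "filterlim (\<lambda>n. real (Suc n) * c) at_top sequentially"
      using that by real_asymp
    then show ?thesis by (rule filterlim_compose[OF Si_at_top])
  qed
  show ?thesis
  proof (cases "c > 0")
    case True then show ?thesis using pos by simp
  next
    case False
    then have "(\<lambda>n. - Si (real (Suc n) * - c)) \<longlonglongrightarrow> - (pi / 2)"
      using assms by (intro tendsto_minus pos) auto
    moreover have "- Si (real (Suc n) * - c) = Si (real (Suc n) * c)" for n
      using Si_neg[of "real (Suc n) * - c"] False assms by (simp add: mult_nonneg_nonpos)
    ultimately show ?thesis using False assms by simp
  qed
qed

text \<open>The two half-line limits \<open>pi / 2\<close> add up for \<open>y\<close> between \<open>a\<close> and \<open>b\<close> and cancel otherwise. The end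
points are excluded: there one of the sine integrals is constantly 0.\<close>

lemma Si_window_tendsto:
  assumes "a < b" "y \<noteq> a" "y \<noteq> b"
  shows "(\<lambda>n. Si (real (Suc n) * (b - y)) - Si (real (Suc n) * (a - y))) \<longlonglongrightarrow> pi * indicator {a<..<b} y"
proof -
  have "(\<lambda>n. Si (real (Suc n) * (b - y)) - Si (real (Suc n) * (a - y))) \<longlonglongrightarrow>
     sgn (b - y) * (pi / 2) - sgn (a - y) * (pi / 2)"
    using assms by (intro tendsto_diff Si_scaled_tendsto) auto
  also have "sgn (b - y) * (pi / 2) - sgn (a - y) * (pi / 2) = pi * indicator {a<..<b} y"
    using assms by (auto simp: sgn_if indicator_def)
  finally show ?thesis .
qed

lemma AE_lborel_component_neq: "AE y::real^'d in lborel. y $ j \<noteq> c"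
proof -
  have "{y::real^'d. y $ j = c} \<in> null_sets lborel"
  proof -
    have "axis j 1 \<in> (Basis :: (real ^ 'd) set)"
      by (auto simp: Basis_vec_def)
    from negligible_standard_hyperplane[OF this, of c] show ?thesis
      by (simp add: negligible_iff_null_sets null_sets_completion_iff cart_eq_inner_axis)
  qed
  then show ?thesis by (auto dest!: AE_not_in)
qed

lemma indicator_box_cart:
  fixes a b x :: "real ^ 'd"
  shows "(indicator (box a b) x :: real) = (\<Prod>j\<in>UNIV. indicator {a $ j<..<b $ j} (x $ j))"
proof -
  have *: "(\<Prod>j\<in>UNIV. indicator {a $ j<..<b $ j} (x $ j)) = (if \<forall>j. x $ j \<in> {a $ j<..<b $ j} then 1 else (0::real))"
    by (auto simp: indicator_def split: if_splits)
  show ?thesis unfolding * by (auto simp: mem_box_cart indicator_def)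
qed

lemma integrable_box_const: "integrable lborel (\<lambda>x::'a::euclidean_space. indicator (box a b) x * (K::real))"
proof -
  have "integrable lborel (indicator (box a b) :: 'a \<Rightarrow> real)"
    by (rule integrable_real_indicator) (use emeasure_lborel_box_finite[of a b] in auto)
  then show ?thesis by simp
qed

text \<open>Fubini moves the integral over the box inside, where it factorises into integrals of the kernel over
intervals.\<close>

lemma integral_kernel_smoothing_box:
  fixes p :: "real ^ 'd \<Rightarrow> real"
  assumes p: "integrable lborel p" and "R > 0" and ab: "\<And>j. a $ j < b $ j"
  shows "(LINT x:box a b|lborel. (LINT y|lborel. p y * (\<Prod>j\<in>UNIV. fourier_kernel R (x $ j - y $ j))))
     = (LINT y|lborel. p y * (\<Prod>j\<in>UNIV. Si (R * (b $ j - y $ j)) - Si (R * (a $ j - y $ j))))"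
proof -
  have [measurable]: "p \<in> borel_measurable borel"
    using borel_measurable_integrable[OF p] by simp
  have eq: "fourier_kernel R = kernel_deriv 0 R" using kernel_deriv_0[of R] assms by auto
  define F where "F x y = indicator (box a b) x * (p y * (\<Prod>j\<in>UNIV. kernel_deriv 0 R (x $ j - y $ j)))" for x y
  define f where "f j y t = indicator {a $ j<..<b $ j} t * fourier_kernel R (t - y $ j)" for j and y :: "real ^ 'd" and t
  have f: "integrable lborel (f j y)" "(LINT t|lborel. f j y t) = Si (R * (b $ j - y $ j)) - Si (R * (a $ j - y $ j))" for j y
    using integrable_fourier_kernel_Ioo[of R "a $ j" "b $ j" "y $ j"] integral_fourier_kernel_Ioo[of R "a $ j" "b $ j" "y $ j"]
      less_imp_le[OF ab] \<open>R > 0\<close> by (simp_all add: f_def[abs_def] set_integrable_def set_lebesgue_integral_def)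
  have Ff: "F x y = p y * (\<Prod>j\<in>UNIV. f j y (x $ j))" for x y
    by (simp add: F_def f_def indicator_box_cart eq prod.distrib)
  have bound: "norm (F x y) \<le> indicator (box a b) x * (\<bar>p y\<bar> * R ^ CARD('d))" for x y
  proof -
    have "(\<Prod>j\<in>UNIV. \<bar>kernel_deriv 0 R (x $ j - y $ j)\<bar>) \<le> (\<Prod>j\<in>(UNIV::'d set). R)"
      using abs_kernel_deriv_le_power[of R 0] \<open>R > 0\<close> by (intro prod_mono) auto
    then show ?thesis
      by (auto simp: F_def indicator_def abs_mult abs_prod intro!: mult_left_mono)
  qed
  have p_int: "integrable lborel (F x)" for x
    by (rule Bochner_Integration.integrable_bound[where f="\<lambda>y. indicator (box a b) x * (\<bar>p y\<bar> * R ^ CARD('d))"])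
       (use bound[of x] \<open>R > 0\<close> p in \<open>auto simp: F_def[abs_def] abs_mult\<close>)
  have int: "integrable (lborel \<Otimes>\<^sub>M lborel) (case_prod F)"
  proof (rule lborel_pair.Fubini_integrable)
    show m: "case_prod F \<in> borel_measurable (lborel \<Otimes>\<^sub>M lborel)"
      unfolding F_def by measurable
    show "integrable lborel (\<lambda>x. LINT y|lborel. norm (case_prod F (x, y)))"
    proof (rule Bochner_Integration.integrable_bound)
      show "integrable lborel (\<lambda>x. indicator (box a b) x * ((LINT y|lborel. \<bar>p y\<bar>) * R ^ CARD('d)))"
        by (rule integrable_box_const)
      show "AE x in lborel. norm (LINT y|lborel. norm (case_prod F (x, y)))
          \<le> norm (indicator (box a b) x * ((LINT y|lborel. \<bar>p y\<bar>) * R ^ CARD('d)))"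
      proof (rule AE_I2)
        fix x
        have "(LINT y|lborel. norm (F x y)) \<le> (LINT y|lborel. indicator (box a b) x * (\<bar>p y\<bar> * R ^ CARD('d)))"
          using p by (intro integral_mono integrable_norm p_int bound) auto
        then show "norm (LINT y|lborel. norm (case_prod F (x, y)))
          \<le> norm (indicator (box a b) x * ((LINT y|lborel. \<bar>p y\<bar>) * R ^ CARD('d)))"
          by (simp add: order_trans[OF _ abs_ge_self])
      qed
    qed (unfold F_def, measurable)
    show "AE x in lborel. integrable lborel (\<lambda>y. case_prod F (x, y))"
      using p_int by auto
  qed
  have "(LINT x:box a b|lborel. (LINT y|lborel. p y * (\<Prod>j\<in>UNIV. fourier_kernel R (x $ j - y $ j))))
     = (LINT x|lborel. (LINT y|lborel. F x y))"
    by (simp add: set_lebesgue_integral_def F_def eq)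
  also have "\<dots> = (LINT y|lborel. (LINT x|lborel. F x y))"
    by (rule lborel_pair.Fubini_integral[OF int, symmetric])
  also have "\<dots> = (LINT y|lborel. p y * (\<Prod>j\<in>UNIV. Si (R * (b $ j - y $ j)) - Si (R * (a $ j - y $ j))))"
  proof -
    have "(LINT x|lborel. (\<Prod>j\<in>UNIV. f j y (x $ j)))
       = (\<Prod>j\<in>UNIV. Si (R * (b $ j - y $ j)) - Si (R * (a $ j - y $ j)))" for y
      using integral_lborel_cart_prod[of "\<lambda>j. f j y", OF f(1)] by (simp add: f(2))
    then show ?thesis unfolding Ff by simp
  qed
  finally show ?thesis .
qed

text \<open>Both sides of the identity on boxes are limits of the integral of the smoothed density \<open>G\<close> over the
box: pointwise convergence of \<open>G\<close> gives the inverse Fourier integral, and convergence of the sine integrals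
gives the density.\<close>

theorem fourier_inversion_AE:
  fixes p :: "real ^ 'd \<Rightarrow> real"
  assumes p: "integrable lborel p" and nn: "\<And>x. 0 \<le> p x" and mom: "finite_fourier_moment p []"
  shows "AE x in lborel. p x = fourier_inverse_deriv p [] x"
proof -
  let ?g = "fourier_inverse_deriv p []"
  have [measurable]: "p \<in> borel_measurable borel"
    using borel_measurable_integrable[OF p] by simp
  have [measurable]: "?g \<in> borel_measurable borel"
    by (rule borel_measurable_continuous_onI, rule continuous_on_fourier_inverse_deriv[OF _ mom]) measurable
  define K where "K = (LINT s|lborel. abs_monomial [] s * cmod (fourier_transform p s)) / (2 * pi) ^ CARD('d)"
  have box_int: "set_integrable lborel (box a b) h" if [measurable]: "h \<in> borel_measurable borel" and "\<And>x. \<bar>h x\<bar> \<le> K"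
    for h :: "real ^ 'd \<Rightarrow> real" and a b
  proof -
    have "integrable lborel (\<lambda>x::real^'d. indicator (box a b) x * K)"
      by (rule integrable_box_const)
    then show ?thesis
      unfolding set_integrable_def
      by (rule Bochner_Integration.integrable_bound)
         (use that in \<open>auto simp: indicator_def order_trans[OF _ abs_ge_self]\<close>)
  qed
  have g_bound: "\<bar>?g x\<bar> \<le> K" for x
    unfolding K_def by (rule fourier_inverse_deriv_bound[OF _ mom]) measurable
  have p_box: "set_integrable lborel (box a b) p" for a b
    unfolding set_integrable_def by (intro integrable_mult_indicator p) auto
  have eq: "(LINT x:box a b|lborel. p x) = (LINT x:box a b|lborel. ?g x)" if ab: "\<And>j. a $ j < b $ j" for a b
  proof (rule LIMSEQ_unique)
    define G where "G R x = (LINT y|lborel. p y * (\<Prod>j\<in>UNIV. fourier_kernel R (x $ j - y $ j))) / pi ^ CARD('d)" for R x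
    have G: "G R x = (LINT y|lborel. p y * (\<Prod>j\<in>UNIV. kernel_deriv (count_list [] j) R (x $ j - y $ j))) / pi ^ CARD('d)"
      if "R \<ge> 0" for R x
      using that by (simp add: G_def kernel_deriv_0)
    have "(\<lambda>n. LINT x|lborel. indicator (box a b) x * G (real (Suc n)) x) \<longlonglongrightarrow> (LINT x|lborel. indicator (box a b) x * ?g x)"
    proof (rule integral_dominated_convergence)
      show "integrable lborel (\<lambda>x::real^'d. indicator (box a b) x * K)"
        by (rule integrable_box_const)
      have "(\<lambda>n. G (real (Suc n)) x) \<longlonglongrightarrow> ?g x" for x
        \<comment> \<open>the limits are taken along \<open>R = Suc n\<close> since the sine-integral formula requires \<open>R > 0\<close>\<close>
        using LIMSEQ_Suc[OF kernel_smoothing_tendsto_fourier_inverse[OF p mom, of x]]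
        by (simp only: G of_nat_0_le_iff)
      then show "AE x in lborel. (\<lambda>n. indicator (box a b) x * G (real (Suc n)) x) \<longlonglongrightarrow> indicator (box a b) x * ?g x"
        by (intro AE_I2 tendsto_intros)
      show "AE x in lborel. norm (indicator (box a b) x * G (real (Suc n)) x) \<le> indicator (box a b) x * K" for n
        using kernel_smoothing_bound[OF p mom, of "real (Suc n)"]
        by (intro AE_I2) (auto simp: indicator_def G K_def)
      show "(\<lambda>x. indicator (box a b) x * G (real (Suc n)) x) \<in> borel_measurable lborel" for n
        by (simp only: G of_nat_0_le_iff) measurable
    qed measurable
    moreover have "(LINT x|lborel. indicator (box a b) x * G R x) =
        (LINT y|lborel. p y * (\<Prod>j\<in>UNIV. Si (R * (b $ j - y $ j)) - Si (R * (a $ j - y $ j)))) / pi ^ CARD('d)"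
      if "R > 0" for R
      using integral_kernel_smoothing_box[OF p that ab]
      by (simp add: G_def set_lebesgue_integral_def)
    ultimately show "(\<lambda>n. (LINT y|lborel. p y * (\<Prod>j\<in>UNIV. Si (real (Suc n) * (b $ j - y $ j)) - Si (real (Suc n) * (a $ j - y $ j)))) / pi ^ CARD('d))
        \<longlonglongrightarrow> (LINT x:box a b|lborel. ?g x)"
      by (simp add: set_lebesgue_integral_def)
    obtain B where B: "\<And>T. \<bar>Si T\<bar> \<le> B" using bounded_Si by auto
    have "(\<lambda>n. (LINT y|lborel. p y * (\<Prod>j\<in>UNIV. Si (real (Suc n) * (b $ j - y $ j)) - Si (real (Suc n) * (a $ j - y $ j)))))
        \<longlonglongrightarrow> (LINT y|lborel. p y * (\<Prod>j\<in>UNIV. pi * indicator {a $ j<..<b $ j} (y $ j)))"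
    proof (rule integral_dominated_convergence)
      show "integrable lborel (\<lambda>y. p y * (2 * B) ^ CARD('d))" using p by simp
      have "AE y::real^'d in lborel. \<forall>j. y $ j \<noteq> a $ j \<and> y $ j \<noteq> b $ j"
        by (simp add: AE_all_countable AE_lborel_component_neq)
      then show "AE y in lborel. (\<lambda>n. p y * (\<Prod>j\<in>UNIV. Si (real (Suc n) * (b $ j - y $ j)) - Si (real (Suc n) * (a $ j - y $ j))))
          \<longlonglongrightarrow> p y * (\<Prod>j\<in>UNIV. pi * indicator {a $ j<..<b $ j} (y $ j))"
        by eventually_elim (intro tendsto_mult tendsto_const tendsto_prod Si_window_tendsto ab; simp)
      show "AE y in lborel. norm (p y * (\<Prod>j\<in>UNIV. Si (real (Suc n) * (b $ j - y $ j)) - Si (real (Suc n) * (a $ j - y $ j))))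
          \<le> p y * (2 * B) ^ CARD('d)" for n
      proof (rule AE_I2)
        fix y :: "real ^ 'd"
        have "(\<Prod>j\<in>UNIV. \<bar>Si (real (Suc n) * (b $ j - y $ j)) - Si (real (Suc n) * (a $ j - y $ j))\<bar>)
           \<le> (\<Prod>j\<in>(UNIV::'d set). 2 * B)"
        proof (rule prod_mono)
          fix j :: 'd
          show "0 \<le> \<bar>Si (real (Suc n) * (b $ j - y $ j)) - Si (real (Suc n) * (a $ j - y $ j))\<bar> \<and>
             \<bar>Si (real (Suc n) * (b $ j - y $ j)) - Si (real (Suc n) * (a $ j - y $ j))\<bar> \<le> 2 * B"
            using B[of "real (Suc n) * (b $ j - y $ j)"] B[of "real (Suc n) * (a $ j - y $ j)"] by linarith
        qed
        then show "norm (p y * (\<Prod>j\<in>UNIV. Si (real (Suc n) * (b $ j - y $ j)) - Si (real (Suc n) * (a $ j - y $ j))))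
          \<le> p y * (2 * B) ^ CARD('d)"
          using nn[of y] by (simp add: abs_mult abs_prod mult_left_mono)
      qed
    qed measurable
    then have "(\<lambda>n. (LINT y|lborel. p y * (\<Prod>j\<in>UNIV. Si (real (Suc n) * (b $ j - y $ j)) - Si (real (Suc n) * (a $ j - y $ j)))) / pi ^ CARD('d))
        \<longlonglongrightarrow> (LINT y|lborel. p y * (\<Prod>j\<in>UNIV. pi * indicator {a $ j<..<b $ j} (y $ j))) / pi ^ CARD('d)"
      by (intro tendsto_divide tendsto_const) auto
    also have "(LINT y|lborel. p y * (\<Prod>j\<in>UNIV. pi * indicator {a $ j<..<b $ j} (y $ j))) / pi ^ CARD('d)
        = (LINT x:box a b|lborel. p x)"
    proof -
      have "(LINT y|lborel. p y * (\<Prod>j\<in>UNIV. pi * indicator {a $ j<..<b $ j} (y $ j)))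
          = (LINT y|lborel. pi ^ CARD('d) * (indicator (box a b) y * p y))"
        by (intro Bochner_Integration.integral_cong) (simp_all add: prod.distrib indicator_box_cart)
      then show ?thesis by (simp add: set_lebesgue_integral_def)
    qed
    finally show "(\<lambda>n. (LINT y|lborel. p y * (\<Prod>j\<in>UNIV. Si (real (Suc n) * (b $ j - y $ j)) - Si (real (Suc n) * (a $ j - y $ j)))) / pi ^ CARD('d))
        \<longlonglongrightarrow> (LINT x:box a b|lborel. p x)" .
  qed
  have int_max: "set_integrable lborel (box a b) (\<lambda>x. max 0 (?g x))" "set_integrable lborel (box a b) (\<lambda>x. max 0 (- ?g x))"
    "set_integrable lborel (box a b) ?g" for a b
    using g_bound order_trans[OF abs_ge_zero g_bound] by (auto intro!: box_int simp: max_def abs_le_iff)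
  \<comment> \<open>the inverse Fourier integral \<open>?g\<close> has no known sign; moving its negative part to the
    other side leaves two nonnegative functions to compare\<close>
  have "AE x in lborel. p x + max 0 (- ?g x) = max 0 (?g x)"
  proof (rule AE_lborel_eq_of_eq_on_boxes)
    fix a b :: "real ^ 'd"
    assume "\<forall>i\<in>Basis. a \<bullet> i < b \<bullet> i"
    then have ab: "a $ j < b $ j" for j
      by (auto simp: Basis_vec_def cart_eq_inner_axis)
    have "(LINT x:box a b|lborel. p x + max 0 (- ?g x)) = (LINT x:box a b|lborel. p x) + (LINT x:box a b|lborel. max 0 (- ?g x))"
      by (intro set_integral_add p_box int_max)
    also have "\<dots> = (LINT x:box a b|lborel. ?g x + max 0 (- ?g x))"
      unfolding eq[OF ab] by (intro set_integral_add(2)[symmetric] int_max)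
    also have "\<dots> = (LINT x:box a b|lborel. max 0 (?g x))"
      by (intro set_lebesgue_integral_cong) (auto simp: max_def)
    finally show "(LINT x:box a b|lborel. p x + max 0 (- ?g x)) = (LINT x:box a b|lborel. max 0 (?g x))" .
  qed (use nn p_box int_max in \<open>auto intro!: set_integral_add add_nonneg_nonneg\<close>)
  then show ?thesis by eventually_elim (auto simp: max_def split: if_splits)
qed

section \<open>Variance of the estimator\<close>

text \<open>The covariances of distinct summands vanish, and each variance is at most the second moment.\<close>

lemma (in prob_space) expectation_square_centered_sum_le:
  fixes Y :: "'i \<Rightarrow> 'a \<Rightarrow> real"
  assumes fin: "finite I" and indep: "indep_vars (\<lambda>_. borel) Y I"
    and bound: "\<And>k \<omega>. k \<in> I \<Longrightarrow> \<bar>Y k \<omega>\<bar> \<le> C"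
  shows "expectation (\<lambda>\<omega>. ((\<Sum>k\<in>I. Y k \<omega>) - (\<Sum>k\<in>I. expectation (Y k)))\<^sup>2)
       \<le> (\<Sum>k\<in>I. expectation (\<lambda>\<omega>. (Y k \<omega>)\<^sup>2))"
proof -
  have rv [measurable]: "Y k \<in> borel_measurable M" if "k \<in> I" for k
    using indep that by (simp add: indep_vars_def2)
  define Z where "Z k \<omega> = Y k \<omega> - expectation (Y k)" for k \<omega>
  have Y_int: "integrable M (Y k)" if "k \<in> I" for k
    using bound that by (intro integrable_const_bound[of _ C]) auto
  have Y2_int: "integrable M (\<lambda>\<omega>. (Y k \<omega>)\<^sup>2)" if "k \<in> I" for k
  proof (rule integrable_const_bound[of _ "C\<^sup>2"])
    show "AE \<omega> in M. norm ((Y k \<omega>)\<^sup>2) \<le> C\<^sup>2"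
      using bound[OF that] order_trans[OF abs_ge_zero bound[OF that]]
      by (auto simp: abs_le_square_iff[symmetric])
  qed (use that in measurable)
  have Z_indep: "indep_vars (\<lambda>_. borel) Z I"
    unfolding Z_def[abs_def] by (rule indep_vars_compose2[OF indep]) auto
  have Z_int: "integrable M (Z k)" "expectation (Z k) = 0" if "k \<in> I" for k
    using Y_int[OF that] by (simp_all add: Z_def[abs_def] prob_space)
  have ZZ_int: "integrable M (\<lambda>\<omega>. Z k \<omega> * Z l \<omega>)" if "k \<in> I" "l \<in> I" for k l
  proof (rule integrable_const_bound[of _ "(2 * C) * (2 * C)"])
    have Z: "\<bar>Z k \<omega>\<bar> \<le> 2 * C" if "k \<in> I" for k \<omega>
    proof -
      have "\<bar>expectation (Y k)\<bar> \<le> expectation (\<lambda>\<omega>. \<bar>Y k \<omega>\<bar>)"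
        by (rule integral_abs_bound)
      also have "\<dots> \<le> expectation (\<lambda>\<omega>. C)"
        using Y_int[OF that] bound[OF that] by (intro integral_mono) auto
      finally show ?thesis
        using bound[OF that, of \<omega>] unfolding Z_def by (simp add: prob_space)
    qed
    show "AE \<omega> in M. norm (Z k \<omega> * Z l \<omega>) \<le> (2 * C) * (2 * C)"
      unfolding real_norm_def abs_mult
      by (intro AE_I2 mult_mono Z that abs_ge_zero order_trans[OF abs_ge_zero Z[OF that(1)]])
  qed (use that in \<open>auto simp: Z_def\<close>)
  have cross: "expectation (\<lambda>\<omega>. Z k \<omega> * Z l \<omega>) = 0" if "k \<in> I" "l \<in> I" "k \<noteq> l" for k l
  proof -
    have "expectation (\<lambda>\<omega>. \<Prod>m\<in>{k, l}. Z m \<omega>) = (\<Prod>m\<in>{k, l}. expectation (Z m))"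
      using that by (intro indep_vars_lebesgue_integral indep_vars_subset[OF Z_indep]) (auto simp: Z_int)
    then show ?thesis using that by (simp add: Z_int)
  qed
  have "expectation (\<lambda>\<omega>. ((\<Sum>k\<in>I. Y k \<omega>) - (\<Sum>k\<in>I. expectation (Y k)))\<^sup>2)
      = expectation (\<lambda>\<omega>. \<Sum>k\<in>I. \<Sum>l\<in>I. Z k \<omega> * Z l \<omega>)"
    by (simp add: Z_def sum_subtractf power2_eq_square flip: sum_product)
  also have "\<dots> = (\<Sum>k\<in>I. \<Sum>l\<in>I. expectation (\<lambda>\<omega>. Z k \<omega> * Z l \<omega>))"
    by (simp add: ZZ_int Bochner_Integration.integral_sum Bochner_Integration.integrable_sum)
  also have "\<dots> = (\<Sum>k\<in>I. \<Sum>l\<in>I. if l = k then variance (Y k) else 0)"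
  proof (intro sum.cong refl)
    fix k l assume "k \<in> I" "l \<in> I"
    then show "expectation (\<lambda>\<omega>. Z k \<omega> * Z l \<omega>) = (if l = k then variance (Y k) else 0)"
      using cross[of k l] by (cases "l = k") (simp_all add: Z_def power2_eq_square)
  qed
  also have "\<dots> = (\<Sum>k\<in>I. variance (Y k))"
    using fin by simp
  also have "\<dots> \<le> (\<Sum>k\<in>I. expectation (\<lambda>\<omega>. (Y k \<omega>)\<^sup>2))"
    by (intro sum_mono) (simp add: variance_eq Y_int Y2_int)
  finally show ?thesis .
qed

definition kernel_weight :: "'d::finite list \<Rightarrow> real \<Rightarrow> real ^ 'd \<Rightarrow> real ^ 'd \<Rightarrow> real" where
  "kernel_weight u R x y = (\<Prod>j\<in>UNIV. kernel_deriv (count_list u j) R (x $ j - y $ j))"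

lemma borel_measurable_kernel_weight [measurable]: "kernel_weight u R x \<in> borel_measurable borel"
  unfolding kernel_weight_def[abs_def] by measurable

lemma abs_kernel_weight_le:
  fixes x y :: "real ^ 'd"
  assumes "R \<ge> 0"
  shows "\<bar>kernel_weight u R x y\<bar> \<le> R ^ (length u + CARD('d))"
proof -
  have "\<bar>kernel_weight u R x y\<bar> = (\<Prod>j\<in>UNIV. \<bar>kernel_deriv (count_list u j) R (x $ j - y $ j)\<bar>)"
    by (simp add: kernel_weight_def abs_prod)
  also have "\<dots> \<le> (\<Prod>j\<in>UNIV. R ^ Suc (count_list u j))"
    by (intro prod_mono conjI abs_ge_zero abs_kernel_deriv_le_power assms)
  also have "\<dots> = R ^ (\<Sum>j\<in>UNIV. Suc (count_list u j))"
    by (rule power_sum[symmetric])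
  also have "(\<Sum>j\<in>UNIV. Suc (count_list u j)) = length u + CARD('d)"
    using sum_count_set[of u "UNIV :: 'd set"] by (simp add: sum_Suc)
  finally show ?thesis .
qed

text \<open>The exponents \<open>2 k + 1\<close> of the one-dimensional integrals sum to \<open>2 * length u + d\<close>, since the
multiplicities of the coordinates in \<open>u\<close> sum to the length of \<open>u\<close>.\<close>

lemma
  fixes x :: "real ^ 'd"
  assumes "R > 0"
  shows integrable_kernel_weight_square: "integrable lborel (\<lambda>y. (kernel_weight u R x y)\<^sup>2)"
    and integral_kernel_weight_square_le:
      "(LINT y|lborel. (kernel_weight u R x y)\<^sup>2) \<le> (5 * pi) ^ CARD('d) * R ^ (2 * length u + CARD('d))"
proof -
  have eq: "(kernel_weight u R x y)\<^sup>2 = (\<Prod>j\<in>UNIV. (\<lambda>t. (kernel_deriv (count_list u j) R (x $ j - t))\<^sup>2) (y $ j))" for y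
    by (simp add: kernel_weight_def prod_power_distrib)
  note int = integrable_kernel_deriv_square[OF assms]
  show "integrable lborel (\<lambda>y. (kernel_weight u R x y)\<^sup>2)"
    unfolding eq by (rule integrable_lborel_cart_prod[OF int])
  have "(LINT y|lborel. (kernel_weight u R x y)\<^sup>2)
      = (\<Prod>j\<in>UNIV. (LINT t|lborel. (kernel_deriv (count_list u j) R (x $ j - t))\<^sup>2))"
    unfolding eq by (rule integral_lborel_cart_prod[OF int])
  also have "\<dots> \<le> (\<Prod>j\<in>UNIV. 5 * pi * R ^ (2 * count_list u j + 1))"
    by (intro prod_mono conjI integral_kernel_deriv_square_le assms Bochner_Integration.integral_nonneg) simp
  also have "\<dots> = (5 * pi) ^ CARD('d) * R ^ (\<Sum>j\<in>UNIV. 2 * count_list u j + 1)"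
    by (simp add: prod.distrib power_sum power_mult_distrib)
  also have "(\<Sum>j\<in>UNIV. 2 * count_list u j + 1) = 2 * length u + CARD('d)"
    using sum_count_set[of u "UNIV :: 'd set"] by (simp only: sum.distrib flip: sum_distrib_left) simp
  finally show "(LINT y|lborel. (kernel_weight u R x y)\<^sup>2) \<le> (5 * pi) ^ CARD('d) * R ^ (2 * length u + CARD('d))" .
qed

lemma nabla_estimator_eq:
  fixes x :: "real ^ 'd"
  assumes "R \<ge> 0"
  shows "nabla_estimator n R X x \<omega> u = 1 / (real n * pi ^ CARD('d)) * (\<Sum>k<n. kernel_weight u R x (X k \<omega>))"
  by (simp add: nabla_estimator_def nabla_def iter_partial_fourier_density_estimator assms kernel_weight_def)

lemma tensor_expectation_nabla_estimator:
  fixes x :: "real ^ 'd"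
  assumes "iid_sample M n X S p" "prob_density p" "n \<ge> 1" "R > 0"
  shows "tensor_expectation M (nabla_estimator n R X x) u = (LINT y|lborel. p y * kernel_weight u R x y) / pi ^ CARD('d)"
proof -
  interpret prob_space M using assms by (simp add: iid_sample_def)
  have D: "distributed M lborel (X k) (\<lambda>x. ennreal (p x))" if "k < n" for k
    using assms that by (auto simp: iid_sample_def)
  have E: "(LINT \<omega>|M. kernel_weight u R x (X k \<omega>)) = (LINT y|lborel. p y * kernel_weight u R x y)" if "k < n" for k
    by (rule distributed_integral[OF D[OF that], symmetric]) (use assms in \<open>auto simp: prob_density_def\<close>)
  have int: "integrable M (\<lambda>\<omega>. kernel_weight u R x (X k \<omega>))" if "k < n" for k
  proof -
    have [measurable]: "X k \<in> borel_measurable M"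
      using distributed_measurable[OF D[OF that]] by simp
    show ?thesis
      using abs_kernel_weight_le[of R u x] assms by (intro integrable_const_bound) auto
  qed
  have "tensor_expectation M (nabla_estimator n R X x) u
     = 1 / (real n * pi ^ CARD('d)) * (\<Sum>k<n. (LINT \<omega>|M. kernel_weight u R x (X k \<omega>)))"
    using assms int by (simp add: tensor_expectation_def nabla_estimator_eq)
  also have "\<dots> = (LINT y|lborel. p y * kernel_weight u R x y) / pi ^ CARD('d)"
    using assms by (simp add: E)
  finally show ?thesis .
qed

lemma finite_multi_indices: "finite {u :: 'd::finite list. length u = i}"
  and card_multi_indices: "card {u :: 'd::finite list. length u = i} = CARD('d) ^ i"
  using finite_lists_length_eq[of "UNIV :: 'd set" i] card_lists_length_eq[of "UNIV :: 'd set" i] by simp_all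

text \<open>Replacing the density by its bound \<open>B\<close> turns the second moment of a summand into a Lebesgue integral,
which is smaller than the squared supremum of the kernel by a factor of order \<open>R ^ d\<close>.\<close>

lemma variance_nabla_estimator_le:
  fixes x :: "real ^ 'd"
  assumes iid: "iid_sample M n X S p" and p: "prob_density p" and "n \<ge> 1" "R > 0"
    and B: "AE y in lborel. p y \<le> B"
  shows "(LINT \<omega>|M. (nabla_estimator n R X x \<omega> u - tensor_expectation M (nabla_estimator n R X x) u)\<^sup>2)
      \<le> B * (5 / pi) ^ CARD('d) * (R ^ (2 * length u + CARD('d)) / real n)"
proof -
  interpret prob_space M using assms by (simp add: iid_sample_def)
  have p_meas [measurable]: "p \<in> borel_measurable borel"
    using p has_bochner_integral_integrable[of lborel p] by (auto simp: prob_density_def has_bochner_integral_iff)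
  have nn: "\<And>y. 0 \<le> p y" using p by (simp add: prob_density_def)
  have D: "distributed M lborel (X k) (\<lambda>x. ennreal (p x))" if "k < n" for k
    using assms that by (auto simp: iid_sample_def)
  have indep: "indep_vars (\<lambda>_. borel) (\<lambda>k \<omega>. kernel_weight u R x (X k \<omega>)) {..<n}"
    by (rule indep_vars_compose2[where M'="\<lambda>_. borel" and X=X])
       (use iid in \<open>auto simp: iid_sample_def\<close>)
  define V where "V k \<omega> = kernel_weight u R x (X k \<omega>)" for k \<omega>
  define c where "c = 1 / (real n * pi ^ CARD('d))"
  have V_meas [measurable]: "V k \<in> borel_measurable M" if "k < n" for k
  proof -
    have [measurable]: "X k \<in> borel_measurable M"
      using distributed_measurable[OF D[OF that]] by simp
    show ?thesis unfolding V_def[abs_def] by measurable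
  qed
  have V_bound: "\<bar>V k \<omega>\<bar> \<le> R ^ (length u + CARD('d))" for k \<omega>
    unfolding V_def using abs_kernel_weight_le[of R u x] \<open>R > 0\<close> by auto
  have V_int: "integrable M (V k)" if "k < n" for k
    using V_bound that by (intro integrable_const_bound) auto
  have second: "expectation (\<lambda>\<omega>. (V k \<omega>)\<^sup>2) \<le> B * ((5 * pi) ^ CARD('d) * R ^ (2 * length u + CARD('d)))"
    if "k < n" for k
  proof -
    have pW_int: "integrable lborel (\<lambda>y. p y * (kernel_weight u R x y)\<^sup>2)"
    proof (rule Bochner_Integration.integrable_bound)
      show "integrable lborel (\<lambda>y. B * (kernel_weight u R x y)\<^sup>2)"
        using integrable_kernel_weight_square[OF \<open>R > 0\<close>, of u x] by simp
      show "AE y in lborel. norm (p y * (kernel_weight u R x y)\<^sup>2) \<le> norm (B * (kernel_weight u R x y)\<^sup>2)"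
        using B by eventually_elim
          (use nn in \<open>auto simp: abs_mult intro!: mult_right_mono intro: order_trans[OF _ abs_ge_self]\<close>)
    qed measurable
    have "expectation (\<lambda>\<omega>. (V k \<omega>)\<^sup>2) = (LINT y|lborel. p y * (kernel_weight u R x y)\<^sup>2)"
      unfolding V_def by (rule distributed_integral[OF D[OF that], symmetric]) (auto simp: nn)
    also have "\<dots> \<le> (LINT y|lborel. B * (kernel_weight u R x y)\<^sup>2)"
    proof (rule integral_mono_AE[OF pW_int])
      show "integrable lborel (\<lambda>y. B * (kernel_weight u R x y)\<^sup>2)"
        using integrable_kernel_weight_square[OF \<open>R > 0\<close>, of u x] by simp
      show "AE y in lborel. p y * (kernel_weight u R x y)\<^sup>2 \<le> B * (kernel_weight u R x y)\<^sup>2"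
        using B by eventually_elim (auto intro!: mult_right_mono)
    qed
    also have "\<dots> \<le> B * ((5 * pi) ^ CARD('d) * R ^ (2 * length u + CARD('d)))"
    proof -
      have "0 \<le> B"
      proof -
        have "ae_filter (lborel :: (real ^ 'd) measure) \<noteq> bot"
          by (simp add: ae_filter_eq_bot_iff)
        then obtain y where "p y \<le> B" using eventually_happens'[OF _ B] by blast
        then show ?thesis using nn[of y] by linarith
      qed
      then show ?thesis
        using integral_kernel_weight_square_le[OF \<open>R > 0\<close>, of u x] by (simp add: mult_left_mono)
    qed
    finally show ?thesis .
  qed
  have est: "nabla_estimator n R X x \<omega> u = c * (\<Sum>k<n. V k \<omega>)" for \<omega>
    unfolding c_def V_def by (rule nabla_estimator_eq) (use \<open>R > 0\<close> in simp)
  have mean: "tensor_expectation M (nabla_estimator n R X x) u = c * (\<Sum>k<n. expectation (V k))"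
    unfolding tensor_expectation_def est using V_int by simp
  have "(LINT \<omega>|M. (nabla_estimator n R X x \<omega> u - tensor_expectation M (nabla_estimator n R X x) u)\<^sup>2)
      = expectation (\<lambda>\<omega>. c\<^sup>2 * ((\<Sum>k<n. V k \<omega>) - (\<Sum>k<n. expectation (V k)))\<^sup>2)"
    unfolding est mean by (simp only: right_diff_distrib[symmetric] power_mult_distrib)
  also have "\<dots> = c\<^sup>2 * expectation (\<lambda>\<omega>. ((\<Sum>k<n. V k \<omega>) - (\<Sum>k<n. expectation (V k)))\<^sup>2)"
    by simp
  also have "\<dots> \<le> c\<^sup>2 * (\<Sum>k<n. expectation (\<lambda>\<omega>. (V k \<omega>)\<^sup>2))"
    using indep V_bound
    by (intro mult_left_mono expectation_square_centered_sum_le) (auto simp: V_def[abs_def])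
  also have "\<dots> \<le> c\<^sup>2 * (\<Sum>k<n. B * ((5 * pi) ^ CARD('d) * R ^ (2 * length u + CARD('d))))"
    by (intro mult_left_mono sum_mono second) auto
  also have "\<dots> = B * (5 / pi) ^ CARD('d) * (R ^ (2 * length u + CARD('d)) / real n)"
  proof -
    have "c\<^sup>2 * (real n * (b * ((5 * pi) ^ CARD('d) * q))) = b * (5 / pi) ^ CARD('d) * (q / real n)" for b q
      using \<open>n \<ge> 1\<close> unfolding c_def power_mult_distrib power_divide power2_eq_square
      by (simp add: divide_simps)
    then show ?thesis by (simp only: sum_constant card_lessThan)
  qed
  finally show ?thesis .
qed

lemma sup_variance_le:
  fixes p :: "real ^ 'd \<Rightarrow> real"
  assumes iid: "iid_sample M n X S p" and p: "prob_density p" and "n \<ge> 1" "R > 0"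
    and B: "AE y in lborel. p y \<le> B"
  shows "sup_variance M n R X S i
      \<le> ereal (B * (5 / pi) ^ CARD('d) * real (CARD('d) ^ i) * (R ^ (2 * i + CARD('d)) / real n))"
  unfolding sup_variance_def
proof (rule SUP_least)
  fix x
  interpret prob_space M using assms by (simp add: iid_sample_def)
  let ?T = "\<lambda>\<omega> u. nabla_estimator n R X x \<omega> u - tensor_expectation M (nabla_estimator n R X x) u"
  have int: "integrable M (\<lambda>\<omega>. (?T \<omega> u)\<^sup>2)" for u
  proof -
    have [measurable]: "X k \<in> borel_measurable M" if "k < n" for k
      using iid that distributed_measurable[of M lborel "X k"] by (auto simp: iid_sample_def)
    define b where "b = 1 / (real n * pi ^ CARD('d)) * (\<Sum>k<n. R ^ (length u + CARD('d)))
        + \<bar>tensor_expectation M (nabla_estimator n R X x) u\<bar>"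
    have b: "\<bar>?T \<omega> u\<bar> \<le> b" for \<omega>
    proof -
      have "\<bar>nabla_estimator n R X x \<omega> u\<bar>
          = 1 / (real n * pi ^ CARD('d)) * \<bar>\<Sum>k<n. kernel_weight u R x (X k \<omega>)\<bar>"
        using \<open>R > 0\<close> by (simp add: nabla_estimator_eq abs_mult)
      also have "\<dots> \<le> 1 / (real n * pi ^ CARD('d)) * (\<Sum>k<n. R ^ (length u + CARD('d)))"
        using \<open>R > 0\<close>
        by (intro mult_left_mono order_trans[OF sum_abs] sum_mono abs_kernel_weight_le) auto
      finally show ?thesis unfolding b_def by linarith
    qed
    have meas: "(\<lambda>\<omega>. ?T \<omega> u) \<in> borel_measurable M"
      unfolding nabla_estimator_eq[OF less_imp_le[OF \<open>R > 0\<close>]] by measurable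
    show ?thesis
    proof (rule integrable_const_bound)
      show "AE \<omega> in M. norm ((?T \<omega> u)\<^sup>2) \<le> b\<^sup>2"
      proof (rule AE_I2)
        fix \<omega>
        show "norm ((?T \<omega> u)\<^sup>2) \<le> b\<^sup>2"
          using power_mono[OF b[of \<omega>] abs_ge_zero, where n = 2] by simp
      qed
    qed (rule borel_measurable_power[OF meas])
  qed
  have "(LINT \<omega>|M. (tensor_norm2 i (?T \<omega>))\<^sup>2) = (LINT \<omega>|M. (\<Sum>u | length u = i. (?T \<omega> u)\<^sup>2))"
    by (simp add: tensor_norm2_def sum_nonneg)
  also have "\<dots> = (\<Sum>u | length u = i. (LINT \<omega>|M. (?T \<omega> u)\<^sup>2))"
    by (rule Bochner_Integration.integral_sum) (rule int)
  also have "\<dots> \<le> (\<Sum>u :: 'd list | length u = i. B * (5 / pi) ^ CARD('d) * (R ^ (2 * i + CARD('d)) / real n))"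
    using variance_nabla_estimator_le[OF assms] by (intro sum_mono) auto
  also have "\<dots> = B * (5 / pi) ^ CARD('d) * real (CARD('d) ^ i) * (R ^ (2 * i + CARD('d)) / real n)"
    by (simp add: card_multi_indices)
  finally show "ereal (LINT \<omega>|M. (tensor_norm2 i (?T \<omega>))\<^sup>2)
      \<le> ereal (B * (5 / pi) ^ CARD('d) * real (CARD('d) ^ i) * (R ^ (2 * i + CARD('d)) / real n))"
    by simp
qed

section \<open>Bias of the estimator under a Fourier envelope\<close>

text \<open>What the two smoothness classes have in common: the Fourier transform is dominated by a product of copies
of one envelope \<open>w\<close> that has moments up to the order of differentiability.\<close>

locale fourier_envelope =
  fixes p :: "real ^ 'd \<Rightarrow> real" and w :: "real \<Rightarrow> real" and C :: real and r :: nat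
  assumes p: "prob_density p" and C: "C > 0"
    and w_nonneg: "\<And>t. 0 \<le> w t" and w_measurable [measurable]: "w \<in> borel_measurable borel"
    and fourier_bound: "\<And>s. cmod (fourier_transform p s) \<le> C * (\<Prod>j\<in>UNIV. w (s $ j))"
    and moment: "\<And>k. k \<le> r \<Longrightarrow> integrable lborel (\<lambda>t. \<bar>t\<bar> ^ k * w t)"
begin

lemma p_integrable: "integrable lborel p"
  using p by (auto simp: prob_density_def has_bochner_integral_iff)

lemma p_measurable [measurable]: "p \<in> borel_measurable borel"
  using borel_measurable_integrable[OF p_integrable] by simp

lemma p_nonneg: "0 \<le> p x"
  using p by (simp add: prob_density_def)

lemma monomial_transform_le:
  "abs_monomial u s * cmod (fourier_transform p s) \<le> C * (\<Prod>j\<in>UNIV. \<bar>s $ j\<bar> ^ count_list u j * w (s $ j))"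
proof -
  have "abs_monomial u s * cmod (fourier_transform p s) \<le> abs_monomial u s * (C * (\<Prod>j\<in>UNIV. w (s $ j)))"
    by (intro mult_left_mono fourier_bound) simp
  then show ?thesis by (simp add: abs_monomial_def prod.distrib mult_ac)
qed

lemma finite_moment:
  assumes "length u \<le> r"
  shows "finite_fourier_moment p u"
  unfolding finite_fourier_moment_def
proof (rule Bochner_Integration.integrable_bound)
  show "integrable lborel (\<lambda>s::real^'d. C * (\<Prod>j\<in>UNIV. \<bar>s $ j\<bar> ^ count_list u j * w (s $ j)))"
    using moment order_trans[OF count_le_length assms]
    by (intro integrable_mult_right integrable_lborel_cart_prod) auto
  show "AE s in lborel. norm (abs_monomial u s * cmod (fourier_transform p s))
      \<le> norm (C * (\<Prod>j\<in>UNIV. \<bar>s $ j\<bar> ^ count_list u j * w (s $ j)))"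
    using monomial_transform_le by (auto simp: order_trans[OF _ abs_ge_self])
qed measurable

lemma density_AE_eq: "AE x in lborel. p x = fourier_inverse_deriv p [] x"
  by (rule fourier_inversion_AE[OF p_integrable p_nonneg finite_moment]) simp

lemma density_AE_bounded: "\<exists>B>0. AE x in lborel. p x \<le> B"
proof -
  define B where "B = (LINT s|lborel. abs_monomial [] s * cmod (fourier_transform p s)) / (2 * pi) ^ CARD('d)"
  have "fourier_inverse_deriv p [] x \<le> \<bar>B\<bar> + 1" for x
    using fourier_inverse_deriv_bound[OF p_measurable finite_moment, of "[]" x] by (simp add: B_def)
  with density_AE_eq have "AE x in lborel. p x \<le> \<bar>B\<bar> + 1" by auto
  then show ?thesis by (intro exI[of _ "\<bar>B\<bar> + 1"]) auto
qed

definition moment_bound :: real where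
  "moment_bound = (\<Sum>k\<le>r. (LINT t|lborel. \<bar>t\<bar> ^ k * w t))"

lemma moment_le_bound: "k \<le> r \<Longrightarrow> (LINT t|lborel. \<bar>t\<bar> ^ k * w t) \<le> moment_bound"
  unfolding moment_bound_def
  by (rule member_le_sum[of k "{..r}"]) (auto intro!: Bochner_Integration.integral_nonneg simp: w_nonneg)

lemma moment_bound_nonneg: "0 \<le> moment_bound"
  unfolding moment_bound_def by (intro sum_nonneg Bochner_Integration.integral_nonneg) (simp add: w_nonneg)

text \<open>The factor between the bias and a one-dimensional tail of the envelope: \<open>d\<close> choices of the
coordinate outside \<open>[-R, R]\<close>, and at most \<open>moment_bound\<close> for each of the other \<open>d - 1\<close> coordinates.\<close>

definition bias_const :: real where
  "bias_const = C * (real CARD('d) * moment_bound ^ (CARD('d) - 1)) / (2 * pi) ^ CARD('d)"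

lemma bias_const_nonneg: "0 \<le> bias_const"
  using C moment_bound_nonneg by (simp add: bias_const_def)

text \<open>Outside the cube some coordinate exceeds \<open>R\<close>. Summing over the position of this coordinate bounds the
integrand by \<open>d\<close> products of one-dimensional functions, of which one is cut off at \<open>R\<close>.\<close>

lemma frequency_tail_le:
  assumes u: "length u \<le> r"
    and tail: "\<And>k. k \<le> length u \<Longrightarrow> (LINT t|lborel. indicator {t. \<bar>t\<bar> > R} t * (\<bar>t\<bar> ^ k * w t)) \<le> \<tau>"
  shows "(LINT s|lborel. indicator (- freq_box R) s * (abs_monomial u s * cmod (fourier_transform p s)))
    \<le> C * (real CARD('d) * (\<tau> * moment_bound ^ (CARD('d) - 1)))"
proof -
  define f where "f j l t = (if l = j then indicator {t. \<bar>t\<bar> > R} t else 1) * (\<bar>t\<bar> ^ count_list u l * w t)"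
    for j l :: 'd and t :: real
  have cnt: "count_list u l \<le> r" for l by (rule order_trans[OF count_le_length u])
  have f_int: "integrable lborel (f j l)" for j l
    by (rule Bochner_Integration.integrable_bound[OF moment[OF cnt[of l]]])
       (auto simp: f_def[abs_def] indicator_def)
  have f_nn: "0 \<le> f j l t" for j l t by (simp add: f_def w_nonneg)
  have f_le: "(LINT t|lborel. f j l t) \<le> (if l = j then \<tau> else moment_bound)" for j l
    using tail[OF count_le_length] moment_le_bound[OF cnt] by (simp add: f_def)
  have prod_eq: "(\<Prod>l\<in>UNIV. if l = j then \<tau> else moment_bound) = \<tau> * moment_bound ^ (CARD('d) - 1)" for j :: 'd
  proof -
    have "(\<Prod>l\<in>UNIV - {j}. if l = j then \<tau> else moment_bound) = (\<Prod>l\<in>UNIV - {j}. moment_bound)"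
      by (intro prod.cong) auto
    then show ?thesis by (subst prod.remove[of _ j]) (simp_all add: card_Diff_singleton)
  qed
  have "(LINT s|lborel. indicator (- freq_box R) s * (abs_monomial u s * cmod (fourier_transform p s)))
      \<le> (LINT s|lborel. C * (\<Sum>j\<in>UNIV. \<Prod>l\<in>UNIV. f j l (s $ l)))"
  proof (rule integral_mono)
    show "integrable lborel (\<lambda>s. indicator (- freq_box R) s * (abs_monomial u s * cmod (fourier_transform p s)))"
      using integrable_mult_indicator[OF _ finite_moment[OF u, unfolded finite_fourier_moment_def], of "- freq_box R"]
      by simp
    show "integrable lborel (\<lambda>s::real^'d. C * (\<Sum>j\<in>UNIV. \<Prod>l\<in>UNIV. f j l (s $ l)))"
      by (intro integrable_mult_right Bochner_Integration.integrable_sum integrable_lborel_cart_prod f_int)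
    fix s :: "real ^ 'd"
    let ?P = "\<Prod>l\<in>UNIV. \<bar>s $ l\<bar> ^ count_list u l * w (s $ l)"
    have P: "0 \<le> ?P" by (intro prod_nonneg) (simp add: w_nonneg)
    show "indicator (- freq_box R) s * (abs_monomial u s * cmod (fourier_transform p s))
        \<le> C * (\<Sum>j\<in>UNIV. \<Prod>l\<in>UNIV. f j l (s $ l))"
    proof (cases "s \<in> freq_box R")
      case True
      then show ?thesis using C f_nn by (auto intro!: mult_nonneg_nonneg sum_nonneg prod_nonneg)
    next
      case False
      then obtain j where j: "\<bar>s $ j\<bar> > R" by (auto simp: freq_box_def not_le)
      have "?P = (\<Prod>l\<in>UNIV. f j l (s $ l))"
        using j by (intro prod.cong) (auto simp: f_def)
      also have "\<dots> \<le> (\<Sum>j\<in>UNIV. \<Prod>l\<in>UNIV. f j l (s $ l))"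
        using f_nn by (intro member_le_sum prod_nonneg) auto
      finally have "C * ?P \<le> C * (\<Sum>j\<in>UNIV. \<Prod>l\<in>UNIV. f j l (s $ l))"
        using C by (intro mult_left_mono) auto
      then show ?thesis using False monomial_transform_le[of u s] by simp
    qed
  qed
  also have "\<dots> = C * (\<Sum>j\<in>UNIV. \<Prod>l\<in>UNIV. (LINT t|lborel. f j l t))"
    by (simp add: Bochner_Integration.integral_sum integrable_lborel_cart_prod integral_lborel_cart_prod f_int)
  also have "\<dots> \<le> C * (\<Sum>j\<in>(UNIV::'d set). \<Prod>l\<in>UNIV. if l = j then \<tau> else moment_bound)"
    using C by (intro mult_left_mono sum_mono prod_mono conjI f_le Bochner_Integration.integral_nonneg f_nn) auto
  also have "\<dots> = C * (real CARD('d) * (\<tau> * moment_bound ^ (CARD('d) - 1)))"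
    by (simp only: prod_eq sum_constant)
  finally show ?thesis .
qed

lemma sup_bias_le:
  assumes S: "C_class r S p" and iid: "iid_sample M n X S p" and "n \<ge> 1" "R > 0" "i \<le> r"
    and tail: "\<And>k. k \<le> i \<Longrightarrow> (LINT t|lborel. indicator {t. \<bar>t\<bar> > R} t * (\<bar>t\<bar> ^ k * w t)) \<le> \<tau>"
  shows "sup_bias M n R X S p i \<le> ereal (bias_const * \<tau>)"
  unfolding sup_bias_def
proof (rule SUP_least)
  fix x assume "x \<in> S"
  obtain U where U: "open U" "S \<subseteq> U"
    and cont_iter: "\<forall>u. length u \<le> r \<longrightarrow> continuous_on U (iter_partial u p)"
    using S unfolding C_class_def by (elim conjE exE) (rule that; assumption)
  have cont: "continuous_on U p"
    using spec[OF cont_iter, of "[]"] by simp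
  \<comment> \<open>almost everywhere equality becomes equality where the density is continuous\<close>
  have p_eq: "p y = fourier_inverse_deriv p [] y" if "y \<in> U" for y
    by (rule continuous_on_open_eq_of_AE[OF U(1) _ _ density_AE_eq that])
       (use cont in \<open>auto intro!: continuous_on_fourier_inverse_deriv finite_moment\<close>)
  have le: "\<bar>tensor_expectation M (nabla_estimator n R X x) u - nabla p x u\<bar> \<le> bias_const * \<tau>"
    if "length u = i" for u
  proof -
    have u: "length u \<le> r" using that \<open>i \<le> r\<close> by simp
    have "nabla p x u = fourier_inverse_deriv p u x"
      unfolding nabla_def
      by (rule iter_partial_eq_fourier_inverse_deriv[OF p_measurable finite_moment U(1) p_eq u])
         (use \<open>x \<in> S\<close> U in auto)
    then have "\<bar>tensor_expectation M (nabla_estimator n R X x) u - nabla p x u\<bar>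
        \<le> (LINT s|lborel. indicator (- freq_box R) s * (abs_monomial u s * cmod (fourier_transform p s))) / (2 * pi) ^ CARD('d)"
      using kernel_smoothing_fourier_tail[OF p_integrable finite_moment[OF u], of R x] \<open>R > 0\<close>
      unfolding tensor_expectation_nabla_estimator[OF iid p \<open>n \<ge> 1\<close> \<open>R > 0\<close>] kernel_weight_def by simp
    also have "\<dots> \<le> C * (real CARD('d) * (\<tau> * moment_bound ^ (CARD('d) - 1))) / (2 * pi) ^ CARD('d)"
      by (intro divide_right_mono frequency_tail_le u tail) (use that in auto)
    also have "\<dots> = bias_const * \<tau>" by (simp add: bias_const_def)
    finally show ?thesis .
  qed
  have "replicate i undefined \<in> {u :: 'd list. length u = i}" by simp
  then have "{u :: 'd list. length u = i} \<noteq> {}" by blast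
  then show "ereal (tensor_max_norm i (\<lambda>u. tensor_expectation M (nabla_estimator n R X x) u - nabla p x u))
      \<le> ereal (bias_const * \<tau>)"
    using le finite_multi_indices[where 'd='d, of i] by (auto simp: tensor_max_norm_def)
qed

end

section \<open>Tail integrals of the two envelopes\<close>

lemma nn_integral_reflect_tail:
  fixes h :: "real \<Rightarrow> ennreal"
  assumes [measurable]: "h \<in> borel_measurable borel" and "R > 0"
  shows "(\<integral>\<^sup>+s. h \<bar>s\<bar> * indicator {s. \<bar>s\<bar> > R} s \<partial>lborel)
       \<le> 2 * (\<integral>\<^sup>+s. h s * indicator {R..} s \<partial>lborel)"
proof -
  have "(\<integral>\<^sup>+s. h \<bar>s\<bar> * indicator {s. \<bar>s\<bar> > R} s \<partial>lborel)
    \<le> (\<integral>\<^sup>+s. h s * indicator {R..} s + h (- s) * indicator {R..} (- s) \<partial>lborel)"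
    using \<open>R > 0\<close> by (intro nn_integral_mono) (auto simp: indicator_def abs_if)
  also have "\<dots> = (\<integral>\<^sup>+s. h s * indicator {R..} s \<partial>lborel) + (\<integral>\<^sup>+s. h (- s) * indicator {R..} (- s) \<partial>lborel)"
    by (intro nn_integral_add) auto
  also have "(\<integral>\<^sup>+s. h (- s) * indicator {R..} (- s) \<partial>lborel)
      = (\<integral>\<^sup>+s. h s * indicator {R..} s \<partial>distr lborel borel uminus)"
    by (subst nn_integral_distr) auto
  also have "\<dots> = (\<integral>\<^sup>+s. h s * indicator {R..} s \<partial>lborel)"
    by (simp add: lborel_distr_uminus)
  finally show ?thesis by (simp add: mult_2)
qed

lemma
  fixes h :: "real \<Rightarrow> real"
  assumes [measurable]: "h \<in> borel_measurable borel" and nn: "\<And>t. t \<ge> 0 \<Longrightarrow> 0 \<le> h t"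
    and "R > 0" "b \<ge> 0" and tail: "(\<integral>\<^sup>+t. ennreal (h t) * indicator {R..} t \<partial>lborel) \<le> ennreal b"
  shows integrable_even_tail: "integrable lborel (\<lambda>t. indicator {t. \<bar>t\<bar> > R} t * h \<bar>t\<bar>)"
    and integral_even_tail_le: "(LINT t|lborel. indicator {t. \<bar>t\<bar> > R} t * h \<bar>t\<bar>) \<le> 2 * b"
proof -
  have "(\<integral>\<^sup>+t. ennreal (indicator {t. \<bar>t\<bar> > R} t * h \<bar>t\<bar>) \<partial>lborel)
      = (\<integral>\<^sup>+t. ennreal (h \<bar>t\<bar>) * indicator {t. \<bar>t\<bar> > R} t \<partial>lborel)"
    by (intro nn_integral_cong) (auto simp: indicator_def)
  also have "\<dots> \<le> 2 * (\<integral>\<^sup>+t. ennreal (h t) * indicator {R..} t \<partial>lborel)"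
    by (rule nn_integral_reflect_tail) (use \<open>R > 0\<close> in measurable)
  also have "\<dots> \<le> 2 * ennreal b"
    by (intro mult_left_mono tail) simp
  also have "\<dots> = ennreal (2 * b)"
    using \<open>b \<ge> 0\<close> by (simp add: ennreal_mult)
  finally have le: "(\<integral>\<^sup>+t. ennreal (indicator {t. \<bar>t\<bar> > R} t * h \<bar>t\<bar>) \<partial>lborel) \<le> ennreal (2 * b)" .
  show int: "integrable lborel (\<lambda>t. indicator {t. \<bar>t\<bar> > R} t * h \<bar>t\<bar>)"
  proof (rule integrableI_nonneg)
    show "AE t in lborel. 0 \<le> indicator {t. \<bar>t\<bar> > R} t * h \<bar>t\<bar>"
      using nn by auto
    show "(\<integral>\<^sup>+t. ennreal (indicator {t. \<bar>t\<bar> > R} t * h \<bar>t\<bar>) \<partial>lborel) < \<infinity>"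
      using le by (rule le_less_trans) simp
  qed measurable
  have "ennreal (LINT t|lborel. indicator {t. \<bar>t\<bar> > R} t * h \<bar>t\<bar>) \<le> ennreal (2 * b)"
    using le by (subst nn_integral_eq_integral[symmetric]) (use int nn in auto)
  then show "(LINT t|lborel. indicator {t. \<bar>t\<bar> > R} t * h \<bar>t\<bar>) \<le> 2 * b"
    using \<open>b \<ge> 0\<close> by (simp add: ennreal_le_iff)
qed

lemma integrable_even_of_tail:
  fixes h :: "real \<Rightarrow> real"
  assumes [measurable]: "h \<in> borel_measurable borel" and nn: "\<And>t. t \<ge> 0 \<Longrightarrow> 0 \<le> h t"
    and "R > 0" "b \<ge> 0" and tail: "(\<integral>\<^sup>+t. ennreal (h t) * indicator {R..} t \<partial>lborel) \<le> ennreal b"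
    and K: "\<And>t. 0 \<le> t \<Longrightarrow> t \<le> R \<Longrightarrow> h t \<le> K"
  shows "integrable lborel (\<lambda>t. h \<bar>t\<bar>)"
proof -
  have "integrable lborel (\<lambda>t. indicator {-R..R} t * h \<bar>t\<bar>)"
  proof (rule Bochner_Integration.integrable_bound)
    have "integrable lborel (indicator {-R..R} :: real \<Rightarrow> real)"
      by (rule integrable_real_indicator) (auto simp: emeasure_lborel_Icc_eq)
    then show "integrable lborel (\<lambda>t. indicator {-R..R} t * K)"
      by simp
    show "AE t in lborel. norm (indicator {-R..R} t * h \<bar>t\<bar>) \<le> norm (indicator {-R..R} t * K)"
    proof (rule AE_I2)
      fix t :: real
      show "norm (indicator {-R..R} t * h \<bar>t\<bar>) \<le> norm (indicator {-R..R} t * K)"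
        using nn[of "\<bar>t\<bar>"] K[of "\<bar>t\<bar>"]
        by (auto simp: indicator_def intro: order_trans[OF _ abs_ge_self])
    qed
  qed measurable
  moreover have "integrable lborel (\<lambda>t. indicator {t. \<bar>t\<bar> > R} t * h \<bar>t\<bar>)"
    by (rule integrable_even_tail) (use assms in auto)
  ultimately have "integrable lborel (\<lambda>t. indicator {-R..R} t * h \<bar>t\<bar> + indicator {t. \<bar>t\<bar> > R} t * h \<bar>t\<bar>)"
    by (rule Bochner_Integration.integrable_add)
  also have "(\<lambda>t. indicator {-R..R} t * h \<bar>t\<bar> + indicator {t. \<bar>t\<bar> > R} t * h \<bar>t\<bar>) = (\<lambda>t. h \<bar>t\<bar>)"
    by (auto simp: indicator_def fun_eq_iff)
  finally show ?thesis .
qed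

text \<open>The integrand is compared with minus the derivative of \<open>t powr m * exp (- c * t powr \<alpha>)\<close>, where
\<open>m = 1 + i - \<alpha>\<close>. The leading term of that derivative is \<open>c * \<alpha> * t ^ i * exp (- c * t powr \<alpha>)\<close>, and the
condition on \<open>R\<close> ensures that the lower-order term is at most half of it.\<close>

lemma nn_integral_supersmooth_tail_le:
  assumes "\<alpha> > 0" "c > 0" "R > 0" and R: "2 * (real i + 1) \<le> c * \<alpha> * R powr \<alpha>"
  shows "(\<integral>\<^sup>+t. ennreal (t ^ i * exp (- c * t powr \<alpha>)) * indicator {R..} t \<partial>lborel)
      \<le> ennreal (2 / (c * \<alpha>) * (R powr (1 + real i - \<alpha>) * exp (- c * R powr \<alpha>)))"
proof -
  define m where "m = 1 + real i - \<alpha>"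
  define F where "F t = - (t powr m * exp (- c * t powr \<alpha>))" for t
  define f where "f t = (c * \<alpha> * t powr real i - m * t powr (real i - \<alpha>)) * exp (- c * t powr \<alpha>)" for t
  have [measurable]: "f \<in> borel_measurable borel" unfolding f_def[abs_def] by measurable
  have f_ge: "c * \<alpha> / 2 * (t ^ i * exp (- c * t powr \<alpha>)) \<le> f t" if "t \<ge> R" for t
  proof -
    have "t > 0" using that \<open>R > 0\<close> by simp
    have "R powr \<alpha> \<le> t powr \<alpha>" using that \<open>R > 0\<close> \<open>\<alpha> > 0\<close> by (intro powr_mono2) auto
    then have "c * \<alpha> * R powr \<alpha> \<le> c * \<alpha> * t powr \<alpha>" using assms by (intro mult_left_mono) auto
    moreover have "c * \<alpha> / 2 * t powr \<alpha> = (c * \<alpha> * t powr \<alpha>) / 2" by simp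
    moreover have "1 + a - d \<le> X" if "A \<le> B" "X = B / 2" "2 * (a + 1) \<le> A" "d > 0" for a d A B X :: real
      using that by argo
    ultimately have "m \<le> c * \<alpha> / 2 * t powr \<alpha>"
      using R \<open>\<alpha> > 0\<close> unfolding m_def by blast
    then have "m * t powr (real i - \<alpha>) \<le> c * \<alpha> / 2 * t powr \<alpha> * t powr (real i - \<alpha>)"
      by (intro mult_right_mono) auto
    also have "\<dots> = c * \<alpha> / 2 * t powr real i"
      by (simp add: mult.assoc flip: powr_add)
    finally have "m * t powr (real i - \<alpha>) \<le> c * \<alpha> / 2 * t powr real i" .
    moreover have "c * \<alpha> * t powr real i = 2 * (c * \<alpha> / 2 * t powr real i)" by simp
    ultimately have "c * \<alpha> / 2 * t powr real i \<le> c * \<alpha> * t powr real i - m * t powr (real i - \<alpha>)"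
      by linarith
    moreover have "t powr real i = t ^ i" using \<open>t > 0\<close> by (rule powr_realpow)
    ultimately have "c * \<alpha> / 2 * t ^ i \<le> c * \<alpha> * t powr real i - m * t powr (real i - \<alpha>)"
      by simp
    then show ?thesis unfolding f_def mult.assoc[symmetric] by (intro mult_right_mono) auto
  qed
  have f_nn: "0 \<le> f t" if "t \<ge> R" for t
  proof -
    have "0 \<le> c * \<alpha> / 2 * (t ^ i * exp (- c * t powr \<alpha>))"
      using that assms by simp
    then show ?thesis using f_ge[OF that] by linarith
  qed
  have deriv: "DERIV F t :> f t" if "t \<ge> R" for t
  proof -
    have "t > 0" using that \<open>R > 0\<close> by simp
    have "DERIV F t :> - (m * t powr (m - 1) * exp (- c * t powr \<alpha>)
        + exp (- c * t powr \<alpha>) * (- c * (\<alpha> * t powr (\<alpha> - 1))) * t powr m)"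
      unfolding F_def using \<open>t > 0\<close> by (auto intro!: derivative_eq_intros)
    also have "- (m * t powr (m - 1) * exp (- c * t powr \<alpha>)
        + exp (- c * t powr \<alpha>) * (- c * (\<alpha> * t powr (\<alpha> - 1))) * t powr m)
        = (c * \<alpha> * (t powr (\<alpha> - 1) * t powr m) - m * t powr (m - 1)) * exp (- c * t powr \<alpha>)"
      by (simp add: algebra_simps)
    also have "t powr (\<alpha> - 1) * t powr m = t powr real i"
      by (simp add: m_def flip: powr_add)
    also have "m - 1 = real i - \<alpha>" by (simp add: m_def)
    finally show ?thesis unfolding f_def .
  qed
  have lim: "(F \<longlongrightarrow> 0) at_top"
    unfolding F_def using assms by real_asymp
  have "(\<integral>\<^sup>+t. ennreal (t ^ i * exp (- c * t powr \<alpha>)) * indicator {R..} t \<partial>lborel)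
      \<le> (\<integral>\<^sup>+t. ennreal (2 / (c * \<alpha>)) * (ennreal (f t) * indicator {R..} t) \<partial>lborel)"
  proof (rule nn_integral_mono)
    fix t
    have "t ^ i * exp (- c * t powr \<alpha>) \<le> 2 / (c * \<alpha>) * f t" if "t \<ge> R"
      using f_ge[OF that] assms by (simp add: field_simps)
    then show "ennreal (t ^ i * exp (- c * t powr \<alpha>)) * indicator {R..} t
        \<le> ennreal (2 / (c * \<alpha>)) * (ennreal (f t) * indicator {R..} t)"
      using assms f_nn[of t] by (auto simp: indicator_def ennreal_mult[symmetric] intro!: ennreal_leI)
  qed
  also have "\<dots> = ennreal (2 / (c * \<alpha>)) * (\<integral>\<^sup>+t. ennreal (f t) * indicator {R..} t \<partial>lborel)"
    by (rule nn_integral_cmult) measurable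
  also have "(\<integral>\<^sup>+t. ennreal (f t) * indicator {R..} t \<partial>lborel) = ennreal (0 - F R)"
    by (rule nn_integral_FTC_atLeast[OF _ deriv f_nn lim]) measurable
  also have "ennreal (2 / (c * \<alpha>)) * \<dots> = ennreal (2 / (c * \<alpha>) * (R powr m * exp (- c * R powr \<alpha>)))"
    using assms by (simp add: F_def ennreal_mult[symmetric])
  finally show ?thesis unfolding m_def .
qed

lemma nn_integral_ordinary_tail_le:
  assumes "real i + 1 < \<beta>" "R > 0"
  shows "(\<integral>\<^sup>+t. ennreal (t ^ i * (1 / (1 + t powr \<beta>))) * indicator {R..} t \<partial>lborel)
      \<le> ennreal (1 / (\<beta> - (real i + 1)) * (1 / R powr (\<beta> - (real i + 1))))"
proof -
  define m where "m = \<beta> - (real i + 1)"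
  have m: "m > 0" using assms by (simp add: m_def)
  define F where "F t = - (t powr (- m) / m)" for t
  have deriv: "DERIV F t :> t powr (real i - \<beta>)" if "t \<ge> R" for t
  proof -
    have "t > 0" using that \<open>R > 0\<close> by simp
    have "DERIV F t :> - ((- m * t powr (- m - 1)) / m)"
      unfolding F_def using \<open>t > 0\<close> m by (auto intro!: derivative_eq_intros)
    also have "- ((- m * t powr (- m - 1)) / m) = t powr (real i - \<beta>)"
    proof -
      have "- m - 1 = real i - \<beta>" by (simp add: m_def)
      then show ?thesis using m by simp
    qed
    finally show ?thesis .
  qed
  have lim: "(F \<longlongrightarrow> 0) at_top"
    unfolding F_def using m by real_asymp
  have "(\<integral>\<^sup>+t. ennreal (t ^ i * (1 / (1 + t powr \<beta>))) * indicator {R..} t \<partial>lborel)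
      \<le> (\<integral>\<^sup>+t. ennreal (t powr (real i - \<beta>)) * indicator {R..} t \<partial>lborel)"
  proof (rule nn_integral_mono)
    fix t
    have "t ^ i * (1 / (1 + t powr \<beta>)) \<le> t powr (real i - \<beta>)" if "t \<ge> R"
    proof -
      have "t > 0" using that \<open>R > 0\<close> by simp
      then have "t ^ i * (1 / (1 + t powr \<beta>)) \<le> t powr real i * (1 / t powr \<beta>)"
        by (intro mult_mono divide_left_mono mult_pos_pos) (auto simp: powr_realpow add_pos_nonneg)
      then show ?thesis by (simp add: powr_diff)
    qed
    then show "ennreal (t ^ i * (1 / (1 + t powr \<beta>))) * indicator {R..} t
        \<le> ennreal (t powr (real i - \<beta>)) * indicator {R..} t"
      by (auto simp: indicator_def intro!: ennreal_leI)
  qed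
  also have "\<dots> = ennreal (0 - F R)"
    by (rule nn_integral_FTC_atLeast[OF _ deriv _ lim]) auto
  also have "0 - F R = 1 / m * (1 / R powr m)"
    by (simp add: F_def powr_minus_divide)
  finally show ?thesis unfolding m_def .
qed

lemma fourier_envelope_supersmooth:
  fixes p :: "real ^ 'd \<Rightarrow> real"
  assumes "prob_density p" "\<alpha> > 0" "upper_supersmooth \<alpha> C0 C1 p"
  shows "fourier_envelope p (\<lambda>t. exp (- C1 * \<bar>t\<bar> powr \<alpha>)) C0 r"
proof
  have C: "C0 > 0" "C1 > 0" using assms by (auto simp: upper_supersmooth_def)
  then show "C0 > 0" by simp
  show "cmod (fourier_transform p s) \<le> C0 * (\<Prod>j\<in>UNIV. exp (- C1 * \<bar>s $ j\<bar> powr \<alpha>))" for s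
    using assms by (simp add: upper_supersmooth_def exp_sum sum_distrib_left)
  show "integrable lborel (\<lambda>t. \<bar>t\<bar> ^ k * exp (- C1 * \<bar>t\<bar> powr \<alpha>))" for k
  proof -
    \<comment> \<open>the least cut-off at which the tail estimate applies\<close>
    define R where "R = (2 * (real k + 1) / (C1 * \<alpha>)) powr (1 / \<alpha>)"
    have R: "R > 0" "R powr \<alpha> = 2 * (real k + 1) / (C1 * \<alpha>)"
      using C \<open>\<alpha> > 0\<close> by (simp_all add: R_def powr_powr)
    show ?thesis
    proof (rule integrable_even_of_tail[where h = "\<lambda>t. t ^ k * exp (- C1 * t powr \<alpha>)"])
      show "(\<integral>\<^sup>+t. ennreal (t ^ k * exp (- C1 * t powr \<alpha>)) * indicator {R..} t \<partial>lborel)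
          \<le> ennreal (2 / (C1 * \<alpha>) * (R powr (1 + real k - \<alpha>) * exp (- C1 * R powr \<alpha>)))"
        by (rule nn_integral_supersmooth_tail_le) (use C R \<open>\<alpha> > 0\<close> in auto)
      show "t ^ k * exp (- C1 * t powr \<alpha>) \<le> R ^ k" if "0 \<le> t" "t \<le> R" for t
      proof -
        have "t ^ k * exp (- C1 * t powr \<alpha>) \<le> R ^ k * 1"
          using that C by (intro mult_mono power_mono) auto
        then show ?thesis by simp
      qed
    qed (use C R \<open>\<alpha> > 0\<close> in auto)
  qed
qed (use assms in auto)

text \<open>The bound has to cover all \<open>k \<le> i\<close>, because a coordinate may occur in a multi-index of length \<open>i\<close> any
number of times up to \<open>i\<close>; \<open>R \<ge> 1\<close> makes the power for \<open>i\<close> the largest.\<close>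

lemma supersmooth_tail_le:
  assumes "\<alpha> > 0" "c > 0" "R \<ge> 1" and R: "2 * (real i + 1) \<le> c * \<alpha> * R powr \<alpha>" and "k \<le> i"
  shows "(LINT t|lborel. indicator {t. \<bar>t\<bar> > R} t * (\<bar>t\<bar> ^ k * exp (- c * \<bar>t\<bar> powr \<alpha>)))
      \<le> 4 / (c * \<alpha>) * (R powr (max (1 + real i - \<alpha>) 0) * exp (- c * R powr \<alpha>))"
proof -
  have "(LINT t|lborel. indicator {t. \<bar>t\<bar> > R} t * (\<bar>t\<bar> ^ k * exp (- c * \<bar>t\<bar> powr \<alpha>)))
     \<le> 2 * (2 / (c * \<alpha>) * (R powr (1 + real k - \<alpha>) * exp (- c * R powr \<alpha>)))"
  proof (rule integral_even_tail_le[where h = "\<lambda>t. t ^ k * exp (- c * t powr \<alpha>)"])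
    have "2 * (real k + 1) \<le> c * \<alpha> * R powr \<alpha>"
      using R \<open>k \<le> i\<close> by (intro order_trans[OF _ R]) simp
    then show "(\<integral>\<^sup>+t. ennreal (t ^ k * exp (- c * t powr \<alpha>)) * indicator {R..} t \<partial>lborel)
        \<le> ennreal (2 / (c * \<alpha>) * (R powr (1 + real k - \<alpha>) * exp (- c * R powr \<alpha>)))"
      using assms by (intro nn_integral_supersmooth_tail_le) auto
  qed (use assms in auto)
  also have "\<dots> \<le> 2 * (2 / (c * \<alpha>) * (R powr (max (1 + real i - \<alpha>) 0) * exp (- c * R powr \<alpha>)))"
    using assms by (intro mult_left_mono mult_right_mono powr_mono) auto
  finally show ?thesis by simp
qed

lemma fourier_envelope_ordinary:
  fixes p :: "real ^ 'd \<Rightarrow> real"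
  assumes "prob_density p" "\<beta> > 1 + real r" "c0 > 0"
    and "\<And>s. cmod (fourier_transform p s) \<le> c0 * (\<Prod>j\<in>UNIV. 1 / (1 + \<bar>s $ j\<bar> powr \<beta>))"
  shows "fourier_envelope p (\<lambda>t. 1 / (1 + \<bar>t\<bar> powr \<beta>)) c0 r"
proof
  show "integrable lborel (\<lambda>t. \<bar>t\<bar> ^ k * (1 / (1 + \<bar>t\<bar> powr \<beta>)))" if "k \<le> r" for k
  proof (rule integrable_even_of_tail[where h = "\<lambda>t. t ^ k * (1 / (1 + t powr \<beta>))"])
    show "(\<integral>\<^sup>+t. ennreal (t ^ k * (1 / (1 + t powr \<beta>))) * indicator {1..} t \<partial>lborel)
        \<le> ennreal (1 / (\<beta> - (real k + 1)) * (1 / 1 powr (\<beta> - (real k + 1))))"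
      by (rule nn_integral_ordinary_tail_le) (use assms that in auto)
    show "t ^ k * (1 / (1 + t powr \<beta>)) \<le> 1" if "0 \<le> t" "t \<le> 1" for t :: real
    proof -
      have "t ^ k * (1 / (1 + t powr \<beta>)) \<le> 1 * 1"
        using that by (intro mult_mono power_le_one) (auto simp: divide_le_eq_1 add_pos_nonneg)
      then show ?thesis by simp
    qed
  qed (use assms that in auto)
qed (use assms in auto)

text \<open>For \<open>R \<ge> 1\<close> the tail of order \<open>k \<le> i\<close> is at most that of order \<open>i\<close>. For \<open>R < 1\<close> this comparison fails,
but then the negative power of \<open>R\<close> on the right is at least 1 and the full moment suffices.\<close>

lemma (in fourier_envelope) ordinary_tail_le:
  assumes w: "w = (\<lambda>t. 1 / (1 + \<bar>t\<bar> powr \<beta>))" and "\<beta> > 1 + real r" "k \<le> i" "i \<le> r" "R > 0"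
  shows "(LINT t|lborel. indicator {t. \<bar>t\<bar> > R} t * (\<bar>t\<bar> ^ k * w t))
      \<le> (2 / (\<beta> - (real i + 1)) + moment_bound) / R powr (\<beta> - (real i + 1))"
proof -
  define m where "m = \<beta> - (real i + 1)"
  have m: "m > 0" using assms by (simp add: m_def)
  have tail_int: "integrable lborel (\<lambda>t. indicator {t. \<bar>t\<bar> > R} t * (\<bar>t\<bar> ^ l * w t))" if "l \<le> r" for l
    by (rule Bochner_Integration.integrable_bound[OF moment[OF that]]) (auto simp: indicator_def)
  have "(LINT t|lborel. indicator {t. \<bar>t\<bar> > R} t * (\<bar>t\<bar> ^ k * w t))
      \<le> (2 / m + moment_bound) / R powr m"
  proof (cases "R \<ge> 1")
    case True
    have "(LINT t|lborel. indicator {t. \<bar>t\<bar> > R} t * (\<bar>t\<bar> ^ k * w t))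
        \<le> (LINT t|lborel. indicator {t. \<bar>t\<bar> > R} t * (\<bar>t\<bar> ^ i * w t))"
    proof (intro integral_mono tail_int)
      fix t :: real
      show "indicator {t. \<bar>t\<bar> > R} t * (\<bar>t\<bar> ^ k * w t) \<le> indicator {t. \<bar>t\<bar> > R} t * (\<bar>t\<bar> ^ i * w t)"
        using True power_increasing[OF \<open>k \<le> i\<close>, of "\<bar>t\<bar>"] w_nonneg[of t]
        by (auto simp: indicator_def intro!: mult_right_mono)
    qed (use assms(3,4) in auto)
    also have "\<dots> \<le> 2 * (1 / m * (1 / R powr m))"
      unfolding w m_def
      by (rule integral_even_tail_le[where h = "\<lambda>t. t ^ i * (1 / (1 + t powr \<beta>))", OF _ _ \<open>R > 0\<close> _
            nn_integral_ordinary_tail_le[OF _ \<open>R > 0\<close>]])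
         (use assms in auto)
    also have "\<dots> \<le> (2 / m + moment_bound) / R powr m"
      using moment_bound_nonneg by (simp add: add_divide_distrib)
    finally show ?thesis .
  next
    case False
    have "(LINT t|lborel. indicator {t. \<bar>t\<bar> > R} t * (\<bar>t\<bar> ^ k * w t)) \<le> (LINT t|lborel. \<bar>t\<bar> ^ k * w t)"
      using assms w_nonneg by (intro integral_mono tail_int moment) (auto simp: indicator_def)
    also have "\<dots> \<le> moment_bound" using assms by (intro moment_le_bound) simp
    also have "\<dots> \<le> (2 / m + moment_bound) / 1" using m by simp
    also have "\<dots> \<le> (2 / m + moment_bound) / R powr m"
      using False \<open>R > 0\<close> m moment_bound_nonneg
      by (intro divide_left_mono powr_le1) auto
    finally show ?thesis .
  qed
  then show ?thesis by (simp add: m_def)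
qed

lemma (in fourier_envelope) sup_variance_le_const:
  "\<exists>B>0. \<forall>(M :: 'w measure) n X S R i. n \<ge> 1 \<and> iid_sample M n X S p \<and> R > 0 \<longrightarrow>
     sup_variance M n R X S i \<le> ereal (B * (5 / pi) ^ CARD('d) * real (CARD('d) ^ i) * (R ^ (2 * i + CARD('d)) / real n))"
proof -
  obtain B where B: "B > 0" "AE x in lborel. p x \<le> B" using density_AE_bounded by auto
  show ?thesis
  proof (intro exI[of _ B] conjI allI impI)
    fix M :: "'w measure" and n :: nat and X :: "nat \<Rightarrow> 'w \<Rightarrow> real ^ 'd"
      and S :: "(real ^ 'd) set" and R :: real and i :: nat
    assume "n \<ge> 1 \<and> iid_sample M n X S p \<and> R > 0"
    then show "sup_variance M n R X S i
        \<le> ereal (B * (5 / pi) ^ CARD('d) * real (CARD('d) ^ i) * (R ^ (2 * i + CARD('d)) / real n))"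
      by (intro sup_variance_le[OF _ p _ _ B(2)]) auto
  qed (rule B(1))
qed

section \<open>Convergence rates\<close>

text \<open>It remains to choose the constants. The factor \<open>bias_const + 1\<close> in place of \<open>bias_const\<close> makes the
constants of the bias strictly positive. In the supersmooth case \<open>C'\<close> is large enough for the tail estimates
of all orders up to \<open>r\<close> at once.\<close>

theorem theorem3:
  fixes p0 :: "real ^ 'd \<Rightarrow> real" and S :: "(real ^ 'd) set" and r :: nat
  assumes "r \<ge> 1" and "prob_density p0" and "C_class r S p0"
  shows
    "(\<forall>\<alpha> C0 C1. \<alpha> > 0 \<and> upper_supersmooth \<alpha> C0 C1 p0 \<longrightarrow>
       (\<exists>C' (C'i :: nat \<Rightarrow> real) (Cbar :: nat \<Rightarrow> real).
          C' > 0 \<and> (\<forall>i\<in>{1..r}. C'i i > 0 \<and> Cbar i > 0) \<and>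
          (\<forall>(M :: 'w measure) n X R. n \<ge> 1 \<and> iid_sample M n X S p0 \<and> R \<ge> C' \<longrightarrow>
             (\<forall>i\<in>{1..r}.
                sup_bias M n R X S p0 i
                  \<le> ereal (C'i i * R powr (max (1 + real i - \<alpha>) 0) * exp (- C1 * R powr \<alpha>)) \<and>
                sup_variance M n R X S i
                  \<le> ereal (Cbar i * (R ^ (2 * i + CARD('d)) / real n))))))
     \<and>
     (\<forall>\<beta>. \<beta> > 1 + real r \<and> upper_ordinary_smooth \<beta> p0 \<longrightarrow>
       (\<exists>(c :: nat \<Rightarrow> real) (Cbar :: nat \<Rightarrow> real).
          (\<forall>i\<in>{1..r}. c i > 0 \<and> Cbar i > 0) \<and>
          (\<forall>(M :: 'w measure) n X R. n \<ge> 1 \<and> iid_sample M n X S p0 \<and> R > 0 \<longrightarrow>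
             (\<forall>i\<in>{1..r}.
                sup_bias M n R X S p0 i \<le> ereal (c i / R powr (\<beta> - (real i + 1))) \<and>
                sup_variance M n R X S i
                  \<le> ereal (Cbar i * (R ^ (2 * i + CARD('d)) / real n))))))"
proof (intro conjI allI impI, goal_cases)
  case (1 \<alpha> C0 C1)
  then have "\<alpha> > 0" and ss: "upper_supersmooth \<alpha> C0 C1 p0" by auto
  then have const_pos: "C0 > 0" "C1 > 0" by (auto simp: upper_supersmooth_def)
  interpret fourier_envelope p0 "\<lambda>t. exp (- C1 * \<bar>t\<bar> powr \<alpha>)" C0 r
    by (rule fourier_envelope_supersmooth) fact+
  obtain B where B: "B > 0" and var: "\<And>(M :: 'w measure) n X S R i. n \<ge> 1 \<Longrightarrow> iid_sample M n X S p0 \<Longrightarrow> R > 0 \<Longrightarrow>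
     sup_variance M n R X S i \<le> ereal (B * (5 / pi) ^ CARD('d) * real (CARD('d) ^ i) * (R ^ (2 * i + CARD('d)) / real n))"
    using sup_variance_le_const by blast
  define C' where "C' = max 1 ((2 * (real r + 1) / (C1 * \<alpha>)) powr (1 / \<alpha>))"
  have C': "2 * (real i + 1) \<le> C1 * \<alpha> * R powr \<alpha>" if "R \<ge> C'" "i \<le> r" for R i
  proof -
    have "2 * (real i + 1) \<le> 2 * (real r + 1)" using that by simp
    also have "\<dots> = C1 * \<alpha> * ((2 * (real r + 1) / (C1 * \<alpha>)) powr (1 / \<alpha>)) powr \<alpha>"
      using const_pos \<open>\<alpha> > 0\<close> by (simp add: powr_powr)
    also have "\<dots> \<le> C1 * \<alpha> * R powr \<alpha>"
      using that const_pos \<open>\<alpha> > 0\<close> by (intro mult_left_mono powr_mono2) (auto simp: C'_def)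
    finally show ?thesis .
  qed
  show ?case
  proof (intro exI conjI allI impI ballI)
    show "C' > 0" by (simp add: C'_def)
    show "(bias_const + 1) * (4 / (C1 * \<alpha>)) > 0"
      using bias_const_nonneg const_pos \<open>\<alpha> > 0\<close> by (intro mult_pos_pos) auto
    show "B * (5 / pi) ^ CARD('d) * real (CARD('d) ^ i) > 0" for i
      using B by simp
  next
    fix M :: "'w measure" and n :: nat and X :: "nat \<Rightarrow> 'w \<Rightarrow> real ^ 'd" and R :: real and i :: nat
    assume h: "n \<ge> 1 \<and> iid_sample M n X S p0 \<and> R \<ge> C'" and i: "i \<in> {1..r}"
    have "R \<ge> 1" using h by (simp add: C'_def)
    then show "sup_variance M n R X S i
        \<le> ereal (B * (5 / pi) ^ CARD('d) * real (CARD('d) ^ i) * (R ^ (2 * i + CARD('d)) / real n))"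
      using h by (intro var) auto
    let ?\<tau> = "4 / (C1 * \<alpha>) * (R powr (max (1 + real i - \<alpha>) 0) * exp (- C1 * R powr \<alpha>))"
    have "sup_bias M n R X S p0 i \<le> ereal (bias_const * ?\<tau>)"
    proof (rule sup_bias_le[OF assms(3)])
      show "(LINT t|lborel. indicator {t. \<bar>t\<bar> > R} t * (\<bar>t\<bar> ^ k * exp (- C1 * \<bar>t\<bar> powr \<alpha>))) \<le> ?\<tau>"
        if "k \<le> i" for k
        by (rule supersmooth_tail_le[OF \<open>\<alpha> > 0\<close> const_pos(2) \<open>R \<ge> 1\<close> C' that]) (use h i in auto)
    qed (use h i \<open>R \<ge> 1\<close> in auto)
    also have "bias_const * ?\<tau> \<le> (bias_const + 1) * ?\<tau>"
      using const_pos \<open>\<alpha> > 0\<close> by (intro mult_right_mono) auto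
    finally show "sup_bias M n R X S p0 i \<le> ereal ((bias_const + 1) * (4 / (C1 * \<alpha>)) *
        R powr (max (1 + real i - \<alpha>) 0) * exp (- C1 * R powr \<alpha>))"
      by (simp only: mult.assoc ereal_less_eq)
  qed
next
  case (2 \<beta>)
  then have \<beta>: "\<beta> > 1 + real r" and "upper_ordinary_smooth \<beta> p0" by auto
  then obtain c0 where c0: "c0 > 0" "\<And>s. cmod (fourier_transform p0 s) \<le> c0 * (\<Prod>j\<in>UNIV. 1 / (1 + \<bar>s $ j\<bar> powr \<beta>))"
    unfolding upper_ordinary_smooth_def by blast
  interpret fourier_envelope p0 "\<lambda>t. 1 / (1 + \<bar>t\<bar> powr \<beta>)" c0 r
    by (rule fourier_envelope_ordinary[OF assms(2) \<beta> c0])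
  obtain B where B: "B > 0" and var: "\<And>(M :: 'w measure) n X S R i. n \<ge> 1 \<Longrightarrow> iid_sample M n X S p0 \<Longrightarrow> R > 0 \<Longrightarrow>
     sup_variance M n R X S i \<le> ereal (B * (5 / pi) ^ CARD('d) * real (CARD('d) ^ i) * (R ^ (2 * i + CARD('d)) / real n))"
    using sup_variance_le_const by blast
  define a where "a i = 2 / (\<beta> - (real i + 1)) + moment_bound" for i :: nat
  have a: "a i > 0" if "i \<in> {1..r}" for i
    using that \<beta> moment_bound_nonneg by (auto simp: a_def intro!: add_pos_nonneg)
  show ?case
  proof (intro exI conjI allI impI ballI)
    show "(bias_const + 1) * a i > 0" if "i \<in> {1..r}" for i
      using bias_const_nonneg a[OF that] by (intro mult_pos_pos) auto
    show "B * (5 / pi) ^ CARD('d) * real (CARD('d) ^ i) > 0" for i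
      using B by simp
  next
    fix M :: "'w measure" and n :: nat and X :: "nat \<Rightarrow> 'w \<Rightarrow> real ^ 'd" and R :: real and i :: nat
    assume h: "n \<ge> 1 \<and> iid_sample M n X S p0 \<and> R > 0" and i: "i \<in> {1..r}"
    then show "sup_variance M n R X S i
        \<le> ereal (B * (5 / pi) ^ CARD('d) * real (CARD('d) ^ i) * (R ^ (2 * i + CARD('d)) / real n))"
      by (intro var) auto
    let ?\<tau> = "a i / R powr (\<beta> - (real i + 1))"
    have "sup_bias M n R X S p0 i \<le> ereal (bias_const * ?\<tau>)"
    proof (rule sup_bias_le[OF assms(3)])
      show "(LINT t|lborel. indicator {t. \<bar>t\<bar> > R} t * (\<bar>t\<bar> ^ k * (1 / (1 + \<bar>t\<bar> powr \<beta>)))) \<le> ?\<tau>"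
        if "k \<le> i" for k
        unfolding a_def by (rule ordinary_tail_le[OF refl \<beta> that]) (use h i in auto)
    qed (use h i in auto)
    also have "bias_const * ?\<tau> \<le> (bias_const + 1) * ?\<tau>"
      using a[OF i] by (intro mult_right_mono) auto
    finally show "sup_bias M n R X S p0 i \<le> ereal ((bias_const + 1) * a i / R powr (\<beta> - (real i + 1)))"
      by simp
  qed
qed

end
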